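(* Fix a prime power $q$. One can choose, for every pair of coprime integers $n, m \ge 1$, a map $\varrho_{q^n}^m\colon \mathbb{F}_{q^{nm}} \to \mathbb{F}_{q^n}^{m\times m}$ together with a cyclic permutation matrix $P_{q^n}^m \in \{0,1\}^{m\times m}$ such that $\varrho_{q^n}^m$ is an injective $\mathbb{F}_{q^n}$-algebra homomorphism (hence a field embedding) and, for every $\xi \in \mathbb{F}_{q^{nm}}$, $$\varrho_{q^n}^m(\varphi_{q^n}(\xi)) = P_{q^n}^m\, \varrho_{q^n}^m(\xi)\, (P_{q^n}^m)^\top,$$ and such that the whole family is globally compatible in the following sense. For every triple of pairwise coprime integers $n, m, \ell \ge 1$, the composition $$\mathbb{F}_{q^{nm\ell}} \xrightarrow{\ \varrho_{q^{nm}}^\ell\ } \mathbb{F}_{q^{nm}}^{\ell\times\ell} \xrightarrow{\ \varrho_{q^n}^m \text{ applied to each entry}\ } (\mathbb{F}_{q^n}^{m\times m})^{\ell\times\ell} \cong \mathbb{F}_{q^n}^{m\ell\times m\ell}$$ coincides with $\varrho_{q^n}^{m\ell}\colon \mathbb{F}_{q^{nm\ell}} \to \mathbb{F}_{q^n}^{m\ell\times m\ell}$ up to row and column permutations; that is, there is a permutation matrix $Q \in \{0,1\}^{m\ell\times m\ell}$, depending only on $q, n, m, \ell$, such that for every $\xi \in \mathbb{F}_{q^{nm\ell}}$ the image of $\xi$ under this composition equals $Q\,\varrho_{q^n}^{m\ell}(\xi)\,Q^\top$.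
   Context: With $q$ a power of the prime $p$, fix an algebraic closure of $\mathbb{F}_p$ and let $\mathbb{F}_{p^k}$ denote its unique subfield with $p^k$ elements, so that $\mathbb{F}_{p^d} \subseteq \mathbb{F}_{p^k}$ whenever $d \mid k$. For a prime power $s$, $\varphi_s$ denotes the Frobenius map $\xi \mapsto \xi^s$. A cyclic permutation matrix in $\{0,1\}^{m\times m}$ is the permutation matrix of a permutation of the $m$ indices consisting of a single $m$-cycle (the identity if $m = 1$). For a field $K$, $K^{m\times m}$ is the $K$-algebra of $m\times m$ matrices over $K$. The identification $(K^{m\times m})^{\ell\times\ell} \cong K^{m\ell\times m\ell}$ is the block-matrix one: with $0 \le \ddot\imath, \ddot\jmath < \ell$ and $0 \le i, j < m$, the $(i,j)$-entry of the $(\ddot\imath,\ddot\jmath)$-block becomes the $(\ddot\imath m + i, \ddot\jmath m + j)$-entry. *)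

theory Defs
  imports
    "HOL-Algebra.Algebraic_Closure_Type"
    "HOL-Combinatorics.Orbits"
    "Jordan_Normal_Form.Matrix"
begin

abbreviation type_ring :: "'a::field ring" where
  "type_ring \<equiv> ring_of_type_algebra"

text \<open>
  The description below is only meaningful where it has a unique solution, as is the case for
  powers \<open>s = p ^ k\<close> with \<open>k \<ge> 1\<close> when \<open>'a\<close> is an algebraic closure of the
  prime field with \<open>p\<close> elements.
\<close>

definition GF :: "nat \<Rightarrow> 'a::field set" where
  "GF s = (THE F. subfield F (type_ring :: 'a ring) \<and> card F = s)"

definition GF_ring :: "nat \<Rightarrow> 'a::field ring" where
  "GF_ring s = type_ring\<lparr>carrier := GF s\<rparr>"

definition GF_mat_ring :: "nat \<Rightarrow> nat \<Rightarrow> 'a::field mat ring" where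
  "GF_mat_ring s m =
     (ring_mat TYPE('a) m ())\<lparr>carrier := {A \<in> carrier_mat m m. elements_mat A \<subseteq> GF s}\<rparr>"

text \<open>
  Homomorphisms of \<open>GF s\<close>-algebras from \<open>GF t\<close> to the \<open>m \<times> m\<close> matrices over
  \<open>GF s\<close> (intended for \<open>GF s \<subseteq> GF t\<close>).
\<close>

definition GF_algebra_hom :: "nat \<Rightarrow> nat \<Rightarrow> nat \<Rightarrow> ('a::field \<Rightarrow> 'a mat) \<Rightarrow> bool" where
  "GF_algebra_hom s t m \<rho> \<longleftrightarrow>
     \<rho> \<in> Ring.ring_hom (GF_ring t) (GF_mat_ring s m) \<and>
     (\<forall>c \<in> GF s. \<forall>x \<in> GF t. \<rho> (c * x) = c \<cdot>\<^sub>m \<rho> x)"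

definition perm_mat :: "nat \<Rightarrow> (nat \<Rightarrow> nat) \<Rightarrow> 'a::field mat" where
  "perm_mat n \<pi> = mat n n (\<lambda>(i, j). if i = \<pi> j then 1 else 0)"

definition permutation_matrix :: "nat \<Rightarrow> 'a::field mat \<Rightarrow> bool" where
  "permutation_matrix n A \<longleftrightarrow> (\<exists>\<pi>. \<pi> permutes {0..<n} \<and> A = perm_mat n \<pi>)"

definition cyclic_permutation_matrix :: "nat \<Rightarrow> 'a::field mat \<Rightarrow> bool" where
  "cyclic_permutation_matrix n A \<longleftrightarrow>
     (\<exists>\<pi>. \<pi> permutes {0..<n} \<and> cyclic_on \<pi> {0..<n} \<and> A = perm_mat n \<pi>)"

definition flatten_blocks :: "nat \<Rightarrow> nat \<Rightarrow> 'a mat mat \<Rightarrow> 'a mat" where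
  "flatten_blocks m l B =
     mat (m * l) (m * l) (\<lambda>(r, c). B $$ (r div m, c div m) $$ (r mod m, c mod m))"

lemma index_flatten_blocks:
  assumes "I < l" "J < l" "i < m" "j < m"
  shows "flatten_blocks m l B $$ (I * m + i, J * m + j) = B $$ (I, J) $$ (i, j)"
proof -
  have *: "I * m + i < m * l" if "I < l" "i < m" for I i
  proof -
    have "I * m + i < Suc I * m" using that by simp
    also have "\<dots> \<le> l * m" using that by (intro mult_le_mono1) simp
    finally show ?thesis by (simp add: mult.commute)
  qed
  show ?thesis
    using *[OF assms(1,3)] *[OF assms(2,4)] assms by (simp add: flatten_blocks_def)
qed

end

theory Submission
  imports Defs "HOL-Number_Theory.Cong"
begin

text \<open>
  Choose a normal element \<open>\<theta> r\<close> of the extension of degree \<open>r\<close> of the field with \<open>q\<close> elements for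
  every prime power \<open>r\<close>, and let \<open>\<theta> m\<close> be the product of the \<open>\<theta> r\<close> over the prime powers \<open>r\<close>
  exactly dividing \<open>m\<close>. Extensions of coprime degrees are linearly disjoint, so \<open>\<theta> m\<close> is normal of
  degree \<open>m\<close>, it stays normal after enlarging the base field to degree \<open>n\<close> coprime to \<open>m\<close>, and
  \<open>\<theta> (m * l) = \<theta> m * \<theta> l\<close> for coprime \<open>m\<close> and \<open>l\<close>. The map \<open>\<rho> n m\<close> sends an element to the matrix of
  its multiplication with respect to the conjugates of \<open>\<theta> m\<close>. Frobenius permutes these conjugates
  cyclically, and the conjugates of \<open>\<theta> (m * l)\<close> are the products of those of \<open>\<theta> m\<close> and \<open>\<theta> l\<close>, in an
  order given by the Chinese remainder theorem.

  The existence of normal elements follows by splitting the divisors of \<open>X ^ m - 1\<close> into coprime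
  prime powers: each divisor \<open>g\<close> is the annihilator of some element under the Frobenius action.
\<close>

section \<open>Finite subfields\<close>

text \<open>Splitting off a root \<open>a\<close> as \<open>f = (X - a) * g\<close> gives
  \<open>f' = g + (X - a) * g'\<close>. At \<open>a\<close> this makes the value of \<open>g\<close>
  nonzero, so \<open>a\<close> is an additional root; at a root of \<open>g\<close> it passes
  simplicity on to \<open>g\<close>.\<close>

lemma card_roots_eq_degree:
  fixes f :: "'a::field poly"
  assumes root: "\<And>g :: 'a poly. degree g > 0 \<Longrightarrow> \<exists>x. poly g x = 0"
    and sep: "\<And>x. poly f x = 0 \<Longrightarrow> poly (pderiv f) x \<noteq> 0"
    and "f \<noteq> 0"
  shows "card {x. poly f x = 0} = degree f"
  using sep \<open>f \<noteq> 0\<close>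
proof (induction "degree f" arbitrary: f)
  case 0
  then obtain c where "f = [:c:]" by (metis degree_eq_zeroE)
  with 0 show ?case by simp
next
  case (Suc n)
  obtain a where a: "poly f a = 0" using root[of f] Suc.hyps(2) by auto
  obtain g where g: "f = [:-a, 1:] * g" using a by (metis poly_eq_0_iff_dvd dvdE)
  have "g \<noteq> 0" using g Suc.prems by auto
  have deg: "degree f = Suc (degree g)" unfolding g
    by (subst degree_mult_eq) (use \<open>g \<noteq> 0\<close> in auto)
  have der: "poly (pderiv f) x = poly g x + (x - a) * poly (pderiv g) x" for x
    unfolding g pderiv_mult by (simp add: pderiv_pCons algebra_simps)
  have ga: "poly g a \<noteq> 0" using Suc.prems(1)[OF a] der[of a] by simp
  have roots: "{x. poly f x = 0} = insert a {x. poly g x = 0}"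
    unfolding g by auto
  have "card {x. poly g x = 0} = degree g"
  proof (rule Suc.hyps(1))
    show "n = degree g" using deg Suc.hyps(2) by simp
    show "poly (pderiv g) x \<noteq> 0" if "poly g x = 0" for x
      using Suc.prems(1)[of x] der[of x] that g by auto
  qed fact
  then show ?case
    using ga poly_roots_finite[OF \<open>g \<noteq> 0\<close>] by (simp add: roots deg)
qed

section \<open>The type as a HOL-Algebra field\<close>

lemma type_ring_simps [simp]:
  "carrier (type_ring :: 'a::field ring) = UNIV"
  "x \<otimes>\<^bsub>(type_ring :: 'a::field ring)\<^esub> y = x * y"
  "x \<oplus>\<^bsub>(type_ring :: 'a::field ring)\<^esub> y = x + y"
  "\<one>\<^bsub>(type_ring :: 'a::field ring)\<^esub> = 1"
  "\<zero>\<^bsub>(type_ring :: 'a::field ring)\<^esub> = 0"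
  by (simp_all add: ring_of_type_algebra_def)

lemma type_ring_pow [simp]:
  "x [^]\<^bsub>(type_ring :: 'a::field ring)\<^esub> (n :: nat) = x ^ n"
  by (induction n) simp_all

lemma type_ring_a_inv [simp]: "\<ominus>\<^bsub>(type_ring :: 'a::field ring)\<^esub> x = - x"
proof -
  interpret field "type_ring :: 'a ring" by (rule field_from_type_algebra)
  show ?thesis by (rule sum_zero_eq_neg[symmetric]) simp_all
qed

lemma type_ring_m_inv [simp]:
  assumes "x \<noteq> 0"
  shows "inv\<^bsub>(type_ring :: 'a::field ring)\<^esub> x = inverse x"
proof -
  interpret field "type_ring :: 'a ring" by (rule field_from_type_algebra)
  show ?thesis by (rule comm_inv_char) (use assms in auto)
qed

text \<open>HOL-Algebra lists coefficients from the leading one down, \<open>Poly\<close> from the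
  constant term up; hence \<open>rev\<close>.\<close>

lemma type_ring_eval:
  "ring.eval (type_ring :: 'a::field ring) ps x = poly (Poly (rev ps)) x"
proof -
  interpret field "type_ring :: 'a ring" by (rule field_from_type_algebra)
  show ?thesis
    by (induction ps) (simp_all add: Poly_append poly_monom algebra_simps)
qed

text \<open>Bridge from the HOL-Algebra notion, where the multiset of roots of a polynomial over a
  closed field has as many elements as the degree and is therefore nonempty here.\<close>

lemma algebraically_closed_imp_root:
  fixes g :: "'a::field poly"
  assumes "algebraically_closed (type_ring :: 'a ring)" and "degree g > 0"
  shows "\<exists>x. poly g x = 0"
proof -
  interpret algebraically_closed "type_ring :: 'a ring" by fact
  let ?R = "type_ring :: 'a ring"
  define ps where "ps = rev (coeffs g)"
  have "g \<noteq> 0" using assms(2) by auto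
  have poly: "ps \<in> carrier (poly_ring ?R)"
    using \<open>g \<noteq> 0\<close> by (simp add: ps_def univ_poly_def polynomial_def hd_rev last_coeffs_eq_coeff_degree)
  have deg: "length ps - 1 = degree g"
    using \<open>g \<noteq> 0\<close> by (simp add: ps_def length_coeffs_degree)
  have "size (roots ps) = degree g"
    using roots_over_carrier[OF poly] deg by (simp add: splitted_def)
  then have "roots ps \<noteq> {#}" using assms(2) by auto
  then obtain x where "x \<in># roots ps" by blast
  then have "is_root ps x" using roots_mem_iff_is_root[OF poly] by simp
  then show ?thesis
    by (auto simp: is_root_def type_ring_eval ps_def)
qed

lemma type_ring_subfieldI:
  fixes F :: "'a::field set"
  assumes "1 \<in> F" and "\<And>x. x \<in> F \<Longrightarrow> - x \<in> F" and "\<And>x y. x \<in> F \<Longrightarrow> y \<in> F \<Longrightarrow> x * y \<in> F"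
    and "\<And>x y. x \<in> F \<Longrightarrow> y \<in> F \<Longrightarrow> x + y \<in> F" and "\<And>x. x \<in> F \<Longrightarrow> inverse x \<in> F"
  shows "subfield F (type_ring :: 'a ring)"
proof -
  interpret field "type_ring :: 'a ring" by (rule field_from_type_algebra)
  show ?thesis
    by (rule subfieldI', rule subringI) (use assms in auto)
qed

lemma type_ring_subfieldD:
  fixes F :: "'a::field set"
  assumes "subfield F (type_ring :: 'a ring)"
  shows "0 \<in> F" "1 \<in> F" "\<And>x y. x \<in> F \<Longrightarrow> y \<in> F \<Longrightarrow> x * y \<in> F"
    "\<And>x y. x \<in> F \<Longrightarrow> y \<in> F \<Longrightarrow> x + y \<in> F" "\<And>x. x \<in> F \<Longrightarrow> - x \<in> F"
  using subringE[OF subfieldE(1)[OF assms]] by simp_all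

text \<open>Translation by \<open>1\<close> permutes \<open>F\<close>, so the sum of its elements
  does not change when \<open>card F\<close> copies of \<open>1\<close> are added.\<close>

lemma of_nat_card_subfield:
  fixes F :: "'a::field set"
  assumes F: "subfield F (type_ring :: 'a ring)" and "finite F"
  shows "of_nat (card F) = (0 :: 'a)"
proof -
  note D = type_ring_subfieldD[OF F]
  have "bij_betw (\<lambda>x. x + 1) F F"
    by (rule bij_betwI[where g = "\<lambda>x. x + - 1"]) (use D in \<open>auto simp del: add_uminus_conv_diff\<close>)
  then have "(\<Sum>x\<in>F. x + 1) = \<Sum>F" by (rule sum.reindex_bij_betw[where g = "\<lambda>x. x"])
  then show ?thesis by (simp add: sum.distrib)
qed

text \<open>Multiplication by a nonzero \<open>x\<close> permutes the nonzero elements of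
  \<open>F\<close>; comparing their products shows that \<open>x\<close> to the power
  \<open>card F - 1\<close> is \<open>1\<close>.\<close>

lemma power_card_subfield:
  fixes F :: "'a::field set"
  assumes F: "subfield F (type_ring :: 'a ring)" and "finite F" and x: "x \<in> F"
  shows "x ^ card F = x"
proof (cases "x = 0")
  case True
  then show ?thesis using assms by (auto simp: power_0_left card_eq_0_iff)
next
  case False
  note D = type_ring_subfieldD[OF F]
  have inj: "inj_on ((*) x) (F - {0})" using False by (auto intro: inj_onI)
  have "(*) x ` (F - {0}) = F - {0}"
    by (rule endo_inj_surj) (use \<open>finite F\<close> False D x inj in auto)
  then have "prod (\<lambda>y. y) (F - {0}) = prod (\<lambda>y. x * y) (F - {0})"
    using prod.reindex[OF inj, of "\<lambda>y. y"] by simp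
  also have "\<dots> = x ^ card (F - {0}) * prod (\<lambda>y. y) (F - {0})"
    by (simp add: prod.distrib)
  finally have "x ^ card (F - {0}) = 1" using \<open>finite F\<close> by simp
  moreover have "card F = Suc (card (F - {0}))"
    using \<open>finite F\<close> D(1) by (rule card.remove)
  ultimately show ?thesis by simp
qed

section \<open>Finite subfields of the closure as fixed points of power maps\<close>

context
  fixes K :: "'a::field set" and p :: nat
  assumes p: "Factorial_Ring.prime p"
    and closure: "algebraic_closure (type_ring :: 'a ring) K"
    and card_K: "card K = p"
begin

lemma CHAR_eq: "CHAR('a) = p"
proof -
  interpret algebraic_closure "type_ring :: 'a ring" K by (rule closure)
  have "finite K" using p card_K by (metis card.infinite not_prime_0)
  then have "of_nat p = (0 :: 'a)"
    using of_nat_card_subfield[OF subfield_axioms] card_K by simp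
  then have "CHAR('a) dvd p" by (simp add: of_nat_eq_0_iff_char_dvd)
  then show ?thesis using p CHAR_not_1[where ?'a='a] by (metis One_nat_def prime_nat_iff)
qed

lemma prime_power_add: "(x + y :: 'a) ^ (p ^ k) = x ^ (p ^ k) + y ^ (p ^ k)"
  by (rule freshmans_dream') (simp_all add: CHAR_eq p)

text \<open>The fixed points are the roots of \<open>X ^ s - X\<close> for \<open>s = p ^ k\<close>.
  Its derivative is \<open>-1\<close> because \<open>s\<close> vanishes in characteristic
  \<open>p\<close>, so all roots are simple.\<close>

lemma card_fixed_points:
  assumes "k > 0"
  shows "card {x :: 'a. x ^ (p ^ k) = x} = p ^ k"
proof -
  interpret algebraic_closure "type_ring :: 'a ring" K by (rule closure)
  define s where "s = p ^ k"
  have "s > 1" using one_less_power[OF prime_gt_1_nat[OF p] assms] by (simp add: s_def)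
  have s0: "of_nat s = (0 :: 'a)"
    using assms by (simp add: s_def of_nat_eq_0_iff_char_dvd CHAR_eq)
  define f :: "'a poly" where "f = Polynomial.monom 1 s - [:0, 1:]"
  have "degree f = s"
    unfolding f_def diff_conv_add_uminus
    by (subst degree_add_eq_left) (use \<open>s > 1\<close> in \<open>simp_all add: degree_monom_eq\<close>)
  moreover have "card {x. poly f x = 0} = degree f"
  proof (rule card_roots_eq_degree)
    show "\<exists>x. poly g x = 0" if "degree g > 0" for g :: "'a poly"
      using algebraically_closed_imp_root[OF algebraically_closed_axioms that] .
    show "f \<noteq> 0" using \<open>degree f = s\<close> \<open>s > 1\<close> by auto
    have "pderiv f = - 1" by (simp add: f_def pderiv_diff pderiv_monom s0 pderiv_pCons one_pCons)
    then show "poly (pderiv f) x \<noteq> 0" for x by simp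
  qed
  moreover have "{x. poly f x = 0} = {x :: 'a. x ^ s = x}"
    by (auto simp: f_def poly_monom)
  ultimately show ?thesis by (simp add: s_def)
qed

text \<open>Makes the description in \<open>GF\<close> usable: the fixed points form a subfield of
  the right size, and any subfield of that size lies among them by
  \<open>power_card_subfield\<close>, hence equals them.\<close>

lemma GF_eq:
  assumes "k > 0"
  shows "GF (p ^ k) = {x :: 'a. x ^ (p ^ k) = x}"
proof -
  let ?F = "{x :: 'a. x ^ (p ^ k) = x}"
  have pos: "p ^ k > 0" using p by (simp add: prime_gt_0_nat)
  have neg: "(- x) ^ (p ^ k) = - (x ^ (p ^ k))" for x :: 'a
  proof -
    have "x ^ (p ^ k) + (- x) ^ (p ^ k) = (x + - x) ^ (p ^ k)" by (rule prime_power_add[symmetric])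
    also have "\<dots> = 0" using pos by (simp add: power_0_left)
    finally show ?thesis by (metis add_eq_0_iff)
  qed
  have subfield: "subfield ?F (type_ring :: 'a ring)"
    by (rule type_ring_subfieldI)
       (auto simp: prime_power_add power_mult_distrib neg power_inverse)
  have unique: "F = ?F" if F: "subfield F (type_ring :: 'a ring)" "card F = p ^ k" for F
  proof (rule card_subset_eq)
    have "finite F" using F(2) pos by (metis card.infinite less_nat_zero_code)
    then show "F \<subseteq> ?F" using power_card_subfield[OF F(1)] F(2) by auto
    show "card F = card ?F" using F(2) card_fixed_points[OF assms] by simp
    show "finite ?F" using card_fixed_points[OF assms] pos by (metis card.infinite less_nat_zero_code)
  qed
  show ?thesis
    unfolding GF_def
  proof (rule the_equality)
    show "subfield ?F (type_ring :: 'a ring) \<and> card ?F = p ^ k"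
      using subfield card_fixed_points[OF assms] by simp
    show "F = ?F" if "subfield F (type_ring :: 'a ring) \<and> card F = p ^ k" for F
      using unique that by blast
  qed
qed

end

section \<open>Normal elements\<close>

lemma poly_power_decomposition:
  fixes r g :: "'a::field poly"
  assumes "degree r > 0" "g \<noteq> 0"
  obtains k s where "g = r ^ k * s" "\<not> r dvd s"
proof -
  have "\<exists>k s. g = r ^ k * s \<and> \<not> r dvd s"
    using \<open>g \<noteq> 0\<close>
  proof (induction "degree g" arbitrary: g rule: less_induct)
    case less
    show ?case
    proof (cases "r dvd g")
      case False
      then show ?thesis by (intro exI[of _ 0] exI[of _ g]) simp
    next
      case True
      then obtain f where f: "g = r * f" by (elim dvdE)
      with less.prems have "f \<noteq> 0" by auto
      then have "degree f < degree g"
        using f assms(1) by (subst f, subst degree_mult_eq) auto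
      from less.hyps[OF this \<open>f \<noteq> 0\<close>] obtain k s where "f = r ^ k * s" "\<not> r dvd s" by blast
      then show ?thesis using f by (intro exI[of _ "Suc k"] exI[of _ s]) simp
    qed
  qed
  then show ?thesis using that by blast
qed

text \<open>Multiplying the identity for exponent \<open>k\<close> by \<open>u * r\<close> and
  inserting it into \<open>u * r + v * s = 1\<close> raises the exponent by one.\<close>

lemma bezout_power:
  fixes r s :: "'a::comm_ring_1"
  assumes "u * r + v * s = 1"
  shows "\<exists>x y. x * r ^ k + y * s = 1"
proof (induction k)
  case 0
  show ?case by (intro exI[of _ 1] exI[of _ 0]) simp
next
  case (Suc k)
  then obtain x y where xy: "x * r ^ k + y * s = 1" by blast
  have "1 = u * r * (x * r ^ k + y * s) + v * s" by (simp add: xy assms)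
  also have "\<dots> = (u * x) * r ^ Suc k + (u * r * y + v) * s" by (simp add: algebra_simps)
  finally show ?case by metis
qed

text \<open>Writing \<open>h = x * (a * h) + y * (b * h)\<close> shows that \<open>a\<close> and
  \<open>b\<close> each divide \<open>h\<close>; then \<open>a * b\<close> divides both
  summands.\<close>

lemma bezout_dvd_mult:
  fixes x y a b h :: "'a::comm_ring_1"
  assumes bezout: "x * a + y * b = 1" and "a dvd b * h" "b dvd a * h"
  shows "a * b dvd h"
proof -
  have h: "h = x * (a * h) + y * (b * h)"
    using bezout by (metis distrib_right mult.assoc mult_1)
  have "a dvd h" by (subst h) (use assms(2) in auto)
  then have "a * b dvd b * h" using mult_dvd_mono[of a h b b] by (simp add: mult.commute)
  moreover have "b dvd h" by (subst h) (use assms(3) in auto)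
  then have "a * b dvd a * h" by (simp add: mult_dvd_mono)
  ultimately show ?thesis by (subst h) auto
qed

lemma bij_betw_mod_coprime:
  fixes m l :: nat
  assumes "coprime m l" "m > 0" "l > 0"
  shows "bij_betw (\<lambda>k. (k mod m, k mod l)) {..<m * l} ({..<m} \<times> {..<l})"
proof (rule bij_betw_imageI)
  show inj: "inj_on (\<lambda>k. (k mod m, k mod l)) {..<m * l}"
  proof (rule inj_onI)
    fix x y assume *: "x \<in> {..<m * l}" "y \<in> {..<m * l}" "(x mod m, x mod l) = (y mod m, y mod l)"
    then have "[x = y] (mod m * l)"
      using assms(1) by (intro coprime_cong_mult_nat) (auto simp: cong_def)
    with * show "x = y" by (simp add: cong_less_modulus_unique_nat)
  qed
  show "(\<lambda>k. (k mod m, k mod l)) ` {..<m * l} = {..<m} \<times> {..<l}"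
    using assms inj by (intro card_subset_eq) (auto simp: card_image)
qed

text \<open>Records what the later arguments use of the field: additivity of the \<open>q\<close>-th
  power and the number of fixed points of its iterates. The prime \<open>p\<close> and the closure
  return only when the locale is interpreted.\<close>

locale frobenius_field =
  fixes q :: nat and ty :: "'a::field itself"
  assumes q_gt_1: "1 < q"
    and frob_add: "(x + y :: 'a) ^ q = x ^ q + y ^ q"
    and card_fixed: "n > 0 \<Longrightarrow> card {x :: 'a. x ^ (q ^ n) = x} = q ^ n"
begin

section \<open>Iterated Frobenius and its fixed fields\<close>

definition frob :: "nat \<Rightarrow> 'a \<Rightarrow> 'a" where
  "frob k x = x ^ (q ^ k)"

text \<open>In the application this is \<open>GF (q ^ n)\<close> for positive \<open>n\<close>.
  Indexing by the degree over the base field makes inclusion a matter of divisibility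
  (\<open>Fix_dvd\<close>).\<close>

definition Fix :: "nat \<Rightarrow> 'a set" where
  "Fix n = {x. frob n x = x}"

lemma frob_0 [simp]: "frob 0 x = x"
  by (simp add: frob_def)

lemma frob_frob [simp]: "frob k (frob l x) = frob (k + l) x"
  by (simp add: frob_def power_add mult.commute flip: power_mult)

lemma frob_Suc: "frob (Suc k) x = frob k (x ^ q)"
  by (simp add: frob_def flip: power_mult)

lemma frob_1: "frob 1 x = x ^ q"
  by (simp add: frob_def)

lemma frob_plus: "frob k (x + y) = frob k x + frob k y"
  by (induction k arbitrary: x y) (simp_all add: frob_Suc frob_add)

lemma frob_mult: "frob k (x * y) = frob k x * frob k y"
  by (simp add: frob_def power_mult_distrib)

lemma frob_zero [simp]: "frob k 0 = 0"
  using q_gt_1 by (simp add: frob_def power_0_left)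

lemma frob_one [simp]: "frob k 1 = 1"
  by (simp add: frob_def)

lemma frob_minus: "frob k (- x) = - frob k x"
  using frob_plus[of k x "- x"] by (simp add: eq_neg_iff_add_eq_0 add.commute)

lemma frob_diff: "frob k (x - y) = frob k x - frob k y"
  using frob_plus[of k x "- y"] by (simp add: frob_minus)

lemma frob_sum: "frob k (sum f A) = (\<Sum>i\<in>A. frob k (f i))"
  by (induction A rule: infinite_finite_induct) (simp_all add: frob_plus)

lemma frob_divide: "frob k (x / y) = frob k x / frob k y"
  by (simp add: frob_def power_divide)

lemma frob_mult_fixed: "x \<in> Fix n \<Longrightarrow> frob (n * j) x = x"
proof (induction j)
  case (Suc j)
  have "frob (n * Suc j) x = frob (n * j) (frob n x)" by (simp add: add.commute)
  with Suc show ?case by (simp add: Fix_def)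
qed simp

lemma Fix_dvd: "x \<in> Fix n \<Longrightarrow> n dvd k \<Longrightarrow> x \<in> Fix k"
  using frob_mult_fixed by (auto simp: Fix_def elim!: dvdE)

lemma frob_mod: "x \<in> Fix n \<Longrightarrow> frob (k mod n) x = frob k x"
  using frob_mult_fixed[of x n "k div n"] frob_frob[of "k mod n" "n * (k div n)" x] by simp

lemma Fix_simps:
  "0 \<in> Fix n" "1 \<in> Fix n" "x \<in> Fix n \<Longrightarrow> y \<in> Fix n \<Longrightarrow> x + y \<in> Fix n"
  "x \<in> Fix n \<Longrightarrow> y \<in> Fix n \<Longrightarrow> x * y \<in> Fix n" "x \<in> Fix n \<Longrightarrow> y \<in> Fix n \<Longrightarrow> x - y \<in> Fix n"
  "x \<in> Fix n \<Longrightarrow> y \<in> Fix n \<Longrightarrow> x / y \<in> Fix n" "x \<in> Fix n \<Longrightarrow> frob k x \<in> Fix n"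
  "x \<in> Fix n \<Longrightarrow> - x \<in> Fix n"
  by (auto simp: Fix_def frob_plus frob_mult frob_diff frob_divide frob_minus)
     (metis add.commute frob_frob)

lemma Fix_sum: "(\<And>i. i \<in> A \<Longrightarrow> f i \<in> Fix n) \<Longrightarrow> sum f A \<in> Fix n"
  by (induction A rule: infinite_finite_induct) (simp_all add: Fix_simps)

lemma card_Fix: "n > 0 \<Longrightarrow> card (Fix n) = q ^ n"
  using card_fixed by (simp add: Fix_def frob_def)

lemma finite_Fix: "n > 0 \<Longrightarrow> finite (Fix n)"
  using card_Fix[of n] q_gt_1 by (metis card.infinite not_one_less_zero power_not_zero)

text \<open>Bezout gives \<open>n * a = m * b + 1\<close>. Iterates by multiples of \<open>n\<close>
  and of \<open>m\<close> fix \<open>x\<close>, so a single Frobenius does too.\<close>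

lemma Fix_coprime:
  assumes "x \<in> Fix n" "x \<in> Fix m" "coprime n m" "n > 0"
  shows "x \<in> Fix 1"
proof -
  obtain a b where "n * a = m * b + 1"
    using bezout_nat[of n m] assms(3,4) by (auto simp: coprime_iff_gcd_eq_1)
  then have "x = frob (m * b + 1) x" using frob_mult_fixed[OF assms(1), of a] by simp
  also have "\<dots> = frob 1 (frob (m * b) x)" by (simp add: add.commute)
  finally show ?thesis using frob_mult_fixed[OF assms(2), of b] by (simp add: Fix_def)
qed

section \<open>Polynomials over the field with \<open>q\<close> elements, kept inside
  \<open>'a poly\<close>\<close>

definition fixed_polys :: "'a poly set" where
  "fixed_polys = {f. \<forall>i. coeff f i \<in> Fix 1}"

lemma fixed_polysD: "f \<in> fixed_polys \<Longrightarrow> coeff f i \<in> Fix 1"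
  by (simp add: fixed_polys_def)

lemma fixed_polys_simps:
  "0 \<in> fixed_polys" "1 \<in> fixed_polys" 
  "f \<in> fixed_polys \<Longrightarrow> g \<in> fixed_polys \<Longrightarrow> f + g \<in> fixed_polys"
  "f \<in> fixed_polys \<Longrightarrow> g \<in> fixed_polys \<Longrightarrow> f - g \<in> fixed_polys"
  "f \<in> fixed_polys \<Longrightarrow> g \<in> fixed_polys \<Longrightarrow> f * g \<in> fixed_polys"
  "c \<in> Fix 1 \<Longrightarrow> monom c n \<in> fixed_polys"
  unfolding fixed_polys_def
  by (simp_all add: Fix_simps coeff_mult Fix_sum coeff_pCons one_pCons split: nat.split)

lemma fixed_polys_power: "f \<in> fixed_polys \<Longrightarrow> f ^ n \<in> fixed_polys"
  by (induction n) (simp_all add: fixed_polys_simps)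

text \<open>Frobenius on coefficients is a ring endomorphism fixing \<open>f\<close> and
  \<open>g\<close>, so it carries quotient and remainder to another such pair; uniqueness of
  division makes both fixed.\<close>

lemma fixed_polys_div_mod:
  assumes f: "f \<in> fixed_polys" and g: "g \<in> fixed_polys"
  shows "f div g \<in> fixed_polys \<and> f mod g \<in> fixed_polys"
proof (cases "g = 0")
  case True
  then show ?thesis using f by (simp add: fixed_polys_simps)
next
  case False
  define F where "F h = map_poly (frob 1) h" for h
  have coeff_F: "coeff (F h) i = frob 1 (coeff h i)" for h i
    by (simp add: F_def coeff_map_poly)
  have F_add: "F (a + b) = F a + F b" for a b
    by (rule poly_eqI) (simp add: coeff_F frob_plus)
  have F_mult: "F (a * b) = F a * F b" for a b
    by (rule poly_eqI) (simp add: coeff_F coeff_mult frob_sum frob_mult)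
  have fixed: "h \<in> fixed_polys \<longleftrightarrow> F h = h" for h
    by (auto simp: fixed_polys_def Fix_def poly_eq_iff coeff_F)
  have deg: "degree (F h) \<le> degree h" for h by (rule degree_le) (simp add: coeff_F coeff_eq_0)
  have "f = F (f div g) * g + F (f mod g)"
    using f g F_add[of "f div g * g" "f mod g"] by (simp add: F_mult fixed)
  moreover have "F (f mod g) = 0 \<or> degree (F (f mod g)) < degree g"
    using degree_mod_less[OF False, of f] deg[of "f mod g"] by (auto simp: F_def)
  moreover have "f = f div g * g + f mod g" by simp
  moreover note degree_mod_less[OF False, of f]
  moreover have "(a = a' \<and> b = b')"
    if "a * g + b = a' * g + b'" "b = 0 \<or> degree b < degree g" "b' = 0 \<or> degree b' < degree g"
    for a b a' b'
  proof -
    have *: "(u * g + v) div g = u" if "v = 0 \<or> degree v < degree g" for u v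
      using that False by (auto simp: div_poly_less)
    show ?thesis using *[OF that(2), of a] *[OF that(3), of a'] that(1) by auto
  qed
  ultimately show ?thesis unfolding fixed by metis
qed

lemma fixed_polys_ideal_principal:
  assumes sub: "I \<subseteq> fixed_polys" and "f \<in> I" "f \<noteq> 0"
    and closed: "\<And>f g. f \<in> I \<Longrightarrow> g \<in> I \<Longrightarrow> f - g \<in> I" "\<And>f g. f \<in> I \<Longrightarrow> g \<in> fixed_polys \<Longrightarrow> g * f \<in> I"
  obtains d where "d \<in> I" "d \<noteq> 0" "\<And>h. h \<in> I \<Longrightarrow> d dvd h"
proof -
  define d where "d = arg_min degree (\<lambda>h. h \<in> I \<and> h \<noteq> 0)"
  have d: "d \<in> I" "d \<noteq> 0"
    using arg_min_natI[of "\<lambda>h. h \<in> I \<and> h \<noteq> 0" f degree] assms(2,3) by (auto simp: d_def)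
  have "d dvd h" if h: "h \<in> I" for h
  proof -
    have "h mod d = h - h div d * d" by (simp add: minus_div_mult_eq_mod)
    also have "\<dots> \<in> I" using d(1) h sub fixed_polys_div_mod by (intro closed) auto
    finally have mem: "h mod d \<in> I" .
    have "h mod d = 0"
    proof (rule ccontr)
      assume nz: "h mod d \<noteq> 0"
      then have "degree d \<le> degree (h mod d)"
        using mem arg_min_nat_le[of "\<lambda>h. h \<in> I \<and> h \<noteq> 0" "h mod d" degree]
        by (simp flip: d_def)
      then show False using degree_mod_less[OF d(2), of h] nz by simp
    qed
    then show ?thesis by (simp add: mod_eq_0_iff_dvd)
  qed
  with d show ?thesis using that by blast
qed

section \<open>Polynomials acting with \<open>X\<close> as Frobenius (linearized
  polynomials)\<close>

definition frob_op :: "'a poly \<Rightarrow> 'a \<Rightarrow> 'a" where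
  "frob_op f x = (\<Sum>i\<le>degree f. coeff f i * frob i x)"

lemma frob_op_eq_sum:
  assumes "degree f \<le> n"
  shows "frob_op f x = (\<Sum>i\<le>n. coeff f i * frob i x)"
  unfolding frob_op_def
  by (rule sum.mono_neutral_left) (use assms in \<open>auto simp: coeff_eq_0\<close>)

lemma frob_op_0 [simp]: "frob_op 0 x = 0"
  by (simp add: frob_op_def)

lemma frob_op_1 [simp]: "frob_op 1 x = x"
  by (simp add: frob_op_def)

lemma frob_op_zero_right [simp]: "frob_op f 0 = 0"
  by (simp add: frob_op_def)

lemma frob_op_pCons: "frob_op (pCons a f) x = a * x + frob_op f (x ^ q)"
proof -
  have "frob_op (pCons a f) x = (\<Sum>i\<le>Suc (degree f). coeff (pCons a f) i * frob i x)"
    by (rule frob_op_eq_sum) (simp add: degree_pCons_le)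
  also have "\<dots> = a * x + (\<Sum>i\<le>degree f. coeff f i * frob (Suc i) x)"
    by (simp add: sum.atMost_Suc_shift del: sum.atMost_Suc)
  finally show ?thesis by (simp add: frob_op_def frob_Suc)
qed

lemma frob_op_add: "frob_op (f + g) x = frob_op f x + frob_op g x"
proof -
  let ?n = "max (degree f) (degree g)"
  have "frob_op (f + g) x = (\<Sum>i\<le>?n. coeff (f + g) i * frob i x)"
    by (rule frob_op_eq_sum) (simp add: degree_add_le)
  then show ?thesis
    using frob_op_eq_sum[of f ?n x] frob_op_eq_sum[of g ?n x]
    by (simp add: algebra_simps sum.distrib)
qed

lemma frob_op_smult: "frob_op (smult c f) x = c * frob_op f x"
  using frob_op_eq_sum[OF degree_smult_le, of c f x]
  by (simp add: frob_op_def sum_distrib_left mult.assoc)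

lemma frob_op_diff: "frob_op (f - g) x = frob_op f x - frob_op g x"
  using frob_op_add[of f "- g" x] frob_op_smult[of "- 1" g x] by simp

lemma frob_op_add_right: "frob_op f (x + y) = frob_op f x + frob_op f y"
  by (simp add: frob_op_def frob_plus algebra_simps sum.distrib)

lemma frob_op_power_q:
  assumes "g \<in> fixed_polys"
  shows "frob_op g (x ^ q) = frob_op g x ^ q"
proof -
  have "frob 1 (coeff g i) = coeff g i" for i
    using fixed_polysD[OF assms] by (simp add: Fix_def)
  then have "frob 1 (frob_op g x) = frob_op g (frob 1 x)"
    by (simp add: frob_op_def frob_sum frob_mult)
  then show ?thesis by (simp only: frob_1)
qed

text \<open>With additivity this makes \<open>'a\<close> a module over the polynomials with fixed
  coefficients. The coefficients of \<open>g\<close> must be fixed because the powers of Frobenius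
  coming from \<open>f\<close> are moved past them.\<close>

lemma frob_op_mult:
  assumes "g \<in> fixed_polys"
  shows "frob_op (f * g) x = frob_op f (frob_op g x)"
proof (induction f arbitrary: x)
  case 0
  show ?case by simp
next
  case (pCons a f)
  have "frob_op (pCons a f * g) x = a * frob_op g x + frob_op (f * g) (x ^ q)"
    by (simp add: frob_op_add frob_op_smult frob_op_pCons)
  then show ?case
    by (simp add: pCons.IH frob_op_pCons frob_op_power_q[OF assms])
qed

lemma frob_op_Fix:
  assumes "f \<in> fixed_polys" "x \<in> Fix m"
  shows "frob_op f x \<in> Fix m"
  unfolding frob_op_def
  using Fix_dvd[OF fixed_polysD[OF assms(1)], of m] assms(2) by (intro Fix_sum Fix_simps) auto

lemma frob_op_dvd:
  assumes "f dvd g" "f \<in> fixed_polys" "frob_op f x = 0"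
  shows "frob_op g x = 0"
proof -
  obtain k where "g = k * f" using assms(1) by (metis dvd_def mult.commute)
  then show ?thesis using assms by (simp add: frob_op_mult)
qed

text \<open>
  As a polynomial in \<open>x\<close>, \<open>frob_op f x\<close> has degree \<open>q ^ degree f\<close>, which is less than the
  number of elements of \<open>Fix m\<close>.
\<close>

lemma frob_op_nonzero:
  assumes "f \<noteq> 0" "degree f < m"
  shows "\<exists>x\<in>Fix m. frob_op f x \<noteq> 0"
proof (rule ccontr)
  assume "\<not> ?thesis"
  then have zero: "Fix m \<subseteq> {x. frob_op f x = 0}" by auto
  define P where "P = (\<Sum>i\<le>degree f. monom (coeff f i) (q ^ i))"
  have poly_P: "poly P x = frob_op f x" for x
    by (simp add: P_def frob_op_def frob_def poly_sum poly_monom)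
  have inj: "q ^ i = q ^ j \<longleftrightarrow> i = j" for i j
    using q_gt_1 by simp
  \<comment> \<open>The exponents \<open>q ^ i\<close> are distinct, so no terms merge and the
    leading coefficient of \<open>f\<close> survives in \<open>P\<close>.\<close>
  have "coeff P (q ^ degree f) = coeff f (degree f)"
    by (simp add: P_def coeff_sum inj if_distrib cong: if_cong)
  then have "P \<noteq> 0" using assms(1) by auto
  have "degree P \<le> q ^ degree f"
    unfolding P_def
  proof (rule degree_sum_le)
    fix i assume "i \<in> {..degree f}"
    then have "q ^ i \<le> q ^ degree f" using q_gt_1 by simp
    then show "degree (monom (coeff f i) (q ^ i)) \<le> q ^ degree f"
      using degree_monom_le order_trans by blast
  qed simp
  have "q ^ m = card (Fix m)" using assms(2) by (simp add: card_Fix)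
  also have "\<dots> \<le> card {x. poly P x = 0}"
    using zero poly_roots_finite[OF \<open>P \<noteq> 0\<close>] by (intro card_mono) (auto simp: poly_P)
  also have "\<dots> \<le> degree P" using \<open>P \<noteq> 0\<close> by (rule card_poly_roots_bound)
  also note \<open>degree P \<le> q ^ degree f\<close>
  finally show False using q_gt_1 assms(2) by (simp add: not_le)
qed


section \<open>Annihilators under the Frobenius action\<close>

lemma fixed_polys_dvdE:
  assumes "f dvd g" "f \<in> fixed_polys" "g \<in> fixed_polys" "f \<noteq> 0"
  obtains k where "k \<in> fixed_polys" "g = k * f"
  using assms fixed_polys_div_mod[of g f] that[of "g div f"] by simp

lemma fixed_polys_cofactor:
  assumes "f * g \<in> fixed_polys" "f \<in> fixed_polys" "f \<noteq> 0"
  shows "g \<in> fixed_polys"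
  using fixed_polys_div_mod[OF assms(1,2)] assms(3) by simp

text \<open>\<open>min\<close> is irreducibility of \<open>r\<close> over the field with
  \<open>q\<close> elements; in \<open>'a poly\<close> itself \<open>r\<close> may still factor. The
  ideal generated by \<open>r\<close> and \<open>h\<close> has a generator dividing
  \<open>r\<close>. Of positive degree it would be an associate of \<open>r\<close> and force
  \<open>r dvd h\<close>, so it is a constant.\<close>

lemma fixed_polys_bezout:
  assumes r: "r \<in> fixed_polys" "degree r > 0"
    and min: "\<And>d. d \<in> fixed_polys \<Longrightarrow> d dvd r \<Longrightarrow> degree d > 0 \<Longrightarrow> degree r \<le> degree d"
    and h: "h \<in> fixed_polys" "\<not> r dvd h"
  obtains u v where "u \<in> fixed_polys" "v \<in> fixed_polys" "u * r + v * h = 1"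
proof -
  define I where "I = {u * r + v * h | u v. u \<in> fixed_polys \<and> v \<in> fixed_polys}"
  have mem: "u * r + v * h \<in> I" if "u \<in> fixed_polys" "v \<in> fixed_polys" for u v
    using that by (auto simp: I_def)
  have "r \<in> I" "h \<in> I" using mem[of 1 0] mem[of 0 1] by (simp_all add: fixed_polys_simps)
  have sub: "I \<subseteq> fixed_polys" using r(1) h(1) by (auto simp: I_def fixed_polys_simps)
  have diff: "f - g \<in> I" if fg: "f \<in> I" "g \<in> I" for f g
  proof -
    obtain a b where ab: "f = a * r + b * h" "a \<in> fixed_polys" "b \<in> fixed_polys"
      using fg(1) unfolding I_def by blast
    obtain c d where cd: "g = c * r + d * h" "c \<in> fixed_polys" "d \<in> fixed_polys"
      using fg(2) unfolding I_def by blast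
    note * = ab cd
    then have "f - g = (a - c) * r + (b - d) * h" by (simp add: algebra_simps)
    then show ?thesis using mem[of "a - c" "b - d"] * by (simp add: fixed_polys_simps)
  qed
  have mult: "g * f \<in> I" if fg: "f \<in> I" "g \<in> fixed_polys" for f g
  proof -
    obtain a b where *: "f = a * r + b * h" "a \<in> fixed_polys" "b \<in> fixed_polys"
      using fg(1) unfolding I_def by blast
    then have "g * f = (g * a) * r + (g * b) * h" by (simp add: algebra_simps)
    then show ?thesis using mem[of "g * a" "g * b"] * that by (simp add: fixed_polys_simps)
  qed
  have "r \<noteq> 0" using r(2) by auto
  obtain d where d: "d \<in> I" "d \<noteq> 0" "\<And>f. f \<in> I \<Longrightarrow> d dvd f"
    using fixed_polys_ideal_principal[OF sub \<open>r \<in> I\<close> \<open>r \<noteq> 0\<close> diff mult] by blast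
  have "degree d = 0"
  proof (rule ccontr)
    assume "degree d \<noteq> 0"
    with min[of d] d sub \<open>r \<in> I\<close> have le: "degree r \<le> degree d" by auto
    obtain k where k: "k \<in> fixed_polys" "r = k * d"
      using fixed_polys_dvdE[OF d(3)[OF \<open>r \<in> I\<close>]] d sub r(1) by blast
    have "k \<noteq> 0" using k \<open>r \<noteq> 0\<close> by auto
    then have "degree r = degree k + degree d" using k(2) d(2) by (simp add: degree_mult_eq)
    then have "degree k = 0" using le by simp
    then obtain c where "k = [:c:]" by (metis degree_eq_zeroE)
    then have "r dvd d" using k(2) \<open>k \<noteq> 0\<close> by (simp add: smult_dvd_iff)
    then show False using d(3)[OF \<open>h \<in> I\<close>] h(2) dvd_trans by blast
  qed
  then obtain c where c: "d = [:c:]" by (metis degree_eq_zeroE)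
  with d(2) have "c \<noteq> 0" by auto
  have "c \<in> Fix 1" using d(1) sub c fixed_polysD[of d 0] by auto
  then have "monom (1 / c) 0 \<in> fixed_polys" by (intro fixed_polys_simps Fix_simps)
  then have "monom (1 / c) 0 * d \<in> I" by (rule mult[OF d(1)])
  moreover have "monom (1 / c) 0 * d = 1" using \<open>c \<noteq> 0\<close> by (simp add: c monom_0 one_pCons)
  ultimately have "1 \<in> I" by simp
  then show ?thesis unfolding I_def using that by force
qed

text \<open>Let \<open>k > 0\<close> and \<open>X ^ m - 1 = t * r ^ k\<close>. Then
  \<open>t * r ^ (k - 1)\<close> has degree below \<open>m\<close>, so some \<open>x\<close> in
  \<open>Fix m\<close> is not killed by it. Applying \<open>t\<close> to \<open>x\<close> yields an
  element killed by \<open>r ^ k\<close> but not by \<open>r ^ (k - 1)\<close>, and irreducibility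
  of \<open>r\<close> over the base field makes \<open>r ^ k\<close> generate its
  annihilator.\<close>

lemma prime_power_annihilator:
  assumes r: "r \<in> fixed_polys" "degree r > 0"
    and min: "\<And>d. d \<in> fixed_polys \<Longrightarrow> d dvd r \<Longrightarrow> degree d > 0 \<Longrightarrow> degree r \<le> degree d"
    and "m > 0" and dvd: "r ^ k dvd monom 1 m - 1"
  shows "\<exists>x\<in>Fix m. frob_op (r ^ k) x = 0 \<and>
    (\<forall>h\<in>fixed_polys. frob_op h x = 0 \<longrightarrow> r ^ k dvd h)"
proof (cases k)
  case 0
  then show ?thesis by (auto intro: bexI[of _ 0] simp: Fix_simps)
next
  case (Suc k')
  define N :: "'a poly" where "N = monom 1 m - 1"
  have N: "N \<in> fixed_polys" by (simp add: N_def fixed_polys_simps Fix_simps)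
  have coeff_N: "coeff N m = 1" using \<open>m > 0\<close> by (simp add: N_def)
  then have "N \<noteq> 0" by auto
  have "degree N \<le> m"
    unfolding N_def by (rule degree_diff_le) (auto simp: degree_monom_le)
  have N_kill: "frob_op N x = 0" if "x \<in> Fix m" for x
  proof -
    have "frob_op (monom 1 m) x = frob m x"
      by (simp add: frob_op_def degree_monom_eq if_distrib if_distribR cong: if_cong)
    then show ?thesis using that by (simp add: N_def frob_op_diff Fix_def)
  qed
  note rk = fixed_polys_power[OF r(1), of k]
  have "r ^ k \<noteq> 0" using r(2) by auto
  then obtain t where t: "t \<in> fixed_polys" "N = t * r ^ k"
    using fixed_polys_dvdE[OF dvd[folded N_def] rk N] by blast
  define f where "f = r ^ k' * t"
  have "N = r * f" by (simp add: t(2) f_def Suc)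
  then have "f \<noteq> 0" using \<open>N \<noteq> 0\<close> by auto
  have "degree N = degree r + degree f"
    unfolding \<open>N = r * f\<close> by (rule degree_mult_eq) (use r(2) \<open>f \<noteq> 0\<close> in auto)
  then have "degree f < m" using r(2) \<open>degree N \<le> m\<close> by simp
  then obtain x where x: "x \<in> Fix m" "frob_op f x \<noteq> 0"
    using frob_op_nonzero[OF \<open>f \<noteq> 0\<close>] by blast
  define y where "y = frob_op t x"
  have y: "y \<in> Fix m" unfolding y_def using t(1) x(1) by (rule frob_op_Fix)
  have y_kill: "frob_op (r ^ k) y = 0"
    using N_kill[OF x(1)] t by (simp add: y_def mult.commute flip: frob_op_mult)
  have y_nz: "frob_op (r ^ k') y \<noteq> 0"
    using x(2) t(1) by (simp add: y_def f_def flip: frob_op_mult)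
  have "r ^ k dvd h" if h: "h \<in> fixed_polys" "frob_op h y = 0" for h
  proof (cases "h = 0")
    case False
    obtain j h' where h': "h = r ^ j * h'" "\<not> r dvd h'"
      using poly_power_decomposition[OF r(2) False] by blast
    have "r \<noteq> 0" using r(2) by auto
    then have "h' \<in> fixed_polys"
      using fixed_polys_cofactor[OF _ fixed_polys_power[OF r(1)], of j h'] h(1) h'(1) by simp
    show ?thesis
    proof (cases "k \<le> j")
      case True
      then show ?thesis using h'(1) by (simp add: le_imp_power_dvd dvd_mult2)
    next
      case False
      \<comment> \<open>If the exponent \<open>j\<close> of \<open>r\<close> in \<open>h\<close> is
        below \<open>k\<close>, Bezout for the remaining factor \<open>h'\<close> puts
        \<open>r ^ k'\<close> among the polynomials killing \<open>y\<close>, a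
        contradiction.\<close>
      then have split: "r ^ k' = r ^ (k' - j) * r ^ j" using Suc by (simp flip: power_add)
      obtain u v where uv: "u \<in> fixed_polys" "v \<in> fixed_polys" "u * r + v * h' = 1"
        using fixed_polys_bezout[OF r min \<open>h' \<in> fixed_polys\<close> h'(2)] by blast
      have "r ^ k' = r ^ k' * (u * r + v * h')" by (simp add: uv)
      also have "\<dots> = u * r ^ k + v * r ^ (k' - j) * h"
        by (simp add: Suc h' split algebra_simps)
      finally have "frob_op (r ^ k') y = frob_op (u * r ^ k + v * r ^ (k' - j) * h) y" by simp
      also have "\<dots> = 0"
        using rk h y_kill by (simp add: frob_op_add frob_op_mult)
      finally show ?thesis using y_nz by simp
    qed
  qed simp
  with y y_kill show ?thesis by blast
qed

text \<open>Induction on the degree. A divisor \<open>r\<close> of least positive degree over the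
  base field is irreducible there and gives \<open>g = r ^ k * s\<close> with coprime factors.
  Adding an element with annihilator generated by \<open>r ^ k\<close> to one with annihilator
  generated by \<open>s\<close> gives the element for \<open>g\<close>.\<close>

lemma exists_annihilator:
  assumes "m > 0" "g \<in> fixed_polys" "g dvd monom 1 m - 1"
  shows "\<exists>x\<in>Fix m. frob_op g x = 0 \<and>
    (\<forall>h\<in>fixed_polys. frob_op h x = 0 \<longrightarrow> g dvd h)"
  using assms(2,3)
proof (induction "degree g" arbitrary: g rule: less_induct)
  case less
  have "coeff (monom 1 m - 1 :: 'a poly) m = 1" using \<open>m > 0\<close> by simp
  then have "monom 1 m - 1 \<noteq> (0 :: 'a poly)" by (metis coeff_0 zero_neq_one)
  with less.prems have "g \<noteq> 0" by auto
  show ?case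
  proof (cases "degree g = 0")
    case True
    then have "g dvd h" for h
      using \<open>g \<noteq> 0\<close> by (metis degree_eq_zeroE dvd_trans is_unit_pCons_iff pCons_eq_0_iff unit_imp_dvd)
    then show ?thesis by (auto intro: bexI[of _ 0] simp: Fix_simps)
  next
    case False
    let ?P = "\<lambda>d. d \<in> fixed_polys \<and> d dvd g \<and> degree d > 0"
    define r where "r = arg_min degree ?P"
    have r: "r \<in> fixed_polys" "r dvd g" "degree r > 0"
      using arg_min_natI[of ?P g degree] less.prems False by (auto simp: r_def)
    have min: "degree r \<le> degree d" if "d \<in> fixed_polys" "d dvd r" "degree d > 0" for d
      using arg_min_nat_le[of ?P d degree] that r(2) dvd_trans by (auto simp: r_def)
    have "r \<noteq> 0" using r(3) by auto
    obtain k s where s: "g = r ^ k * s" "\<not> r dvd s"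
      using poly_power_decomposition[OF r(3) \<open>g \<noteq> 0\<close>] by blast
    have "k > 0" using s r(2) by (cases k) auto
    note rk = fixed_polys_power[OF r(1), of k]
    have "s \<in> fixed_polys"
      using fixed_polys_cofactor[OF _ rk, of s] less.prems(1) s(1) \<open>r \<noteq> 0\<close> by simp
    have "s \<noteq> 0" using s(1) \<open>g \<noteq> 0\<close> by auto
    have "degree s < degree g"
      using s(1) \<open>s \<noteq> 0\<close> \<open>r \<noteq> 0\<close> r(3) \<open>k > 0\<close> by (simp add: degree_mult_eq degree_power_eq)
    moreover have "s dvd monom 1 m - 1" using less.prems(2) s(1) dvd_trans dvd_triv_right by blast
    ultimately obtain x where x: "x \<in> Fix m" "frob_op s x = 0"
        "\<And>h. h \<in> fixed_polys \<Longrightarrow> frob_op h x = 0 \<Longrightarrow> s dvd h"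
      using less.hyps \<open>s \<in> fixed_polys\<close> by blast
    have "r ^ k dvd monom 1 m - 1" using less.prems(2) s(1) dvd_trans dvd_triv_left by blast
    then obtain y where y: "y \<in> Fix m" "frob_op (r ^ k) y = 0"
        "\<And>h. h \<in> fixed_polys \<Longrightarrow> frob_op h y = 0 \<Longrightarrow> r ^ k dvd h"
      using prime_power_annihilator[OF r(1,3) min \<open>m > 0\<close>] by blast
    obtain u v where "u * r + v * s = 1"
      using fixed_polys_bezout[OF r(1,3) min \<open>s \<in> fixed_polys\<close> s(2)] by blast
    then obtain a b where ab: "a * r ^ k + b * s = 1" using bezout_power by blast
    have "frob_op g (x + y) = 0"
      using frob_op_dvd[OF _ rk y(2), of g] frob_op_dvd[OF _ \<open>s \<in> fixed_polys\<close> x(2), of g] s(1)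
      by (simp add: frob_op_add_right)
    moreover have "g dvd h" if h: "h \<in> fixed_polys" "frob_op h (x + y) = 0" for h
    proof -
      \<comment> \<open>Taking \<open>f\<close> to be \<open>r ^ k\<close> removes the
        \<open>y\<close> side, taking it to be \<open>s\<close> removes the \<open>x\<close> side;
        this yields the crosswise divisibilities for \<open>bezout_dvd_mult\<close>.\<close>
      have kill: "frob_op (f * h) x = - frob_op (f * h) y" for f
        using h by (simp add: frob_op_mult frob_op_add_right flip: eq_neg_iff_add_eq_0)
          (simp add: eq_neg_iff_add_eq_0 flip: frob_op_add_right)
      have "s dvd r ^ k * h"
        using x(3)[of "r ^ k * h"] kill[of "r ^ k"] frob_op_dvd[OF _ rk y(2), of "r ^ k * h"] rk h(1)
        by (simp add: fixed_polys_simps)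
      moreover have "r ^ k dvd s * h"
        using y(3)[of "s * h"] kill[of s] frob_op_dvd[OF _ \<open>s \<in> fixed_polys\<close> x(2), of "s * h"]
          \<open>s \<in> fixed_polys\<close> h(1)
        by (simp add: fixed_polys_simps)
      ultimately show ?thesis unfolding s(1) by (rule bezout_dvd_mult[OF ab, rotated])
    qed
    ultimately show ?thesis using x(1) y(1) Fix_simps(3) by blast
  qed
qed

section \<open>Linear independence and normal elements\<close>

definition indep :: "nat \<Rightarrow> nat set \<Rightarrow> (nat \<Rightarrow> 'a) \<Rightarrow> bool" where
  "indep n A b \<longleftrightarrow>
     (\<forall>c. (\<forall>i\<in>A. c i \<in> Fix n) \<and> (\<Sum>i\<in>A. c i * b i) = 0 \<longrightarrow> (\<forall>i\<in>A. c i = 0))"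

lemma indepD:
  assumes "indep n A b" "\<And>i. i \<in> A \<Longrightarrow> c i \<in> Fix n" "(\<Sum>i\<in>A. c i * b i) = 0" "i \<in> A"
  shows "c i = 0"
  using assms unfolding indep_def by blast

text \<open>Only independence is required; that the conjugates span follows by counting in
  \<open>indep_spanning\<close>.\<close>

definition normal_elt :: "nat \<Rightarrow> 'a \<Rightarrow> bool" where
  "normal_elt m a \<longleftrightarrow> a \<in> Fix m \<and> indep 1 {..<m} (\<lambda>i. frob i a)"

text \<open>Take \<open>a\<close> with annihilator generated by \<open>X ^ m - 1\<close>. A relation
  among its \<open>m\<close> conjugates is a polynomial of degree below \<open>m\<close> that kills
  \<open>a\<close>, hence a multiple of \<open>X ^ m - 1\<close> and so zero.\<close>

lemma normal_elt_exists:
  assumes "m > 0"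
  shows "\<exists>a. normal_elt m a"
proof -
  define N :: "'a poly" where "N = monom 1 m - 1"
  have N: "N \<in> fixed_polys" by (simp add: N_def fixed_polys_simps Fix_simps)
  obtain a where a: "a \<in> Fix m" "\<And>h. h \<in> fixed_polys \<Longrightarrow> frob_op h a = 0 \<Longrightarrow> N dvd h"
    using exists_annihilator[OF assms N] unfolding N_def by auto
  have "indep 1 {..<m} (\<lambda>i. frob i a)"
    unfolding indep_def
  proof (intro allI impI, elim conjE)
    fix c assume c: "\<forall>i\<in>{..<m}. c i \<in> Fix 1" and zero: "(\<Sum>i<m. c i * frob i a) = 0"
    define h where "h = Poly (map c [0..<m])"
    have coeff_h: "coeff h i = (if i < m then c i else 0)" for i
      by (simp add: h_def nth_default_def)
    have "degree h \<le> m - 1" by (rule degree_le) (auto simp: coeff_h)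
    have "h \<in> fixed_polys" using c by (simp add: fixed_polys_def coeff_h Fix_simps)
    moreover have "frob_op h a = (\<Sum>i\<le>m - 1. coeff h i * frob i a)"
      by (rule frob_op_eq_sum) fact
    then have "frob_op h a = 0"
      using zero assms by (simp add: coeff_h lessThan_Suc_atMost[symmetric])
    ultimately have "N dvd h" by (rule a(2))
    have "h = 0"
    proof (rule ccontr)
      assume "h \<noteq> 0"
      then have "degree N \<le> degree h" using \<open>N dvd h\<close> by (rule dvd_imp_degree_le[rotated])
      moreover have "m \<le> degree N" using assms by (intro le_degree) (simp add: N_def)
      ultimately show False using \<open>degree h \<le> m - 1\<close> assms by simp
    qed
    then show "\<forall>i\<in>{..<m}. c i = 0" using coeff_h by (metis coeff_0 lessThan_iff)
  qed
  with a(1) show ?thesis by (auto simp: normal_elt_def)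
qed

text \<open>
  A relation of minimal support, normalized to have one coefficient \<open>1\<close>, is fixed by
  \<open>frob m\<close>, so that its coefficients lie in \<open>Fix n \<inter> Fix m = Fix 1\<close>.
\<close>

lemma indep_coprime:
  assumes indep: "indep 1 A b" and "finite A" and b: "\<And>i. i \<in> A \<Longrightarrow> b i \<in> Fix m"
    and "coprime n m" "n > 0"
  shows "indep n A b"
  unfolding indep_def
proof (intro allI impI, elim conjE)
  fix c assume "\<forall>i\<in>A. c i \<in> Fix n" and "(\<Sum>i\<in>A. c i * b i) = 0"
  then show "\<forall>i\<in>A. c i = 0"
  proof (induction "card {i \<in> A. c i \<noteq> 0}" arbitrary: c rule: less_induct)
    case less
    show ?case
    proof (rule ccontr)
      assume "\<not> (\<forall>i\<in>A. c i = 0)"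
      then obtain j where j: "j \<in> A" "c j \<noteq> 0" by blast
      define d where "d i = c i / c j" for i
      have d: "d i \<in> Fix n" if "i \<in> A" for i
        using that j less.prems(1) by (simp add: d_def Fix_simps)
      have "(\<Sum>i\<in>A. d i * b i) = (\<Sum>i\<in>A. c i * b i) / c j"
        by (simp add: d_def sum_divide_distrib)
      then have d_sum: "(\<Sum>i\<in>A. d i * b i) = 0" using less.prems(2) by simp
      \<comment> \<open>Applying \<open>frob m\<close> to the normalized relation leaves every
        \<open>b i\<close> unchanged, so the difference \<open>e\<close> is again a relation. Its
        support is smaller, since \<open>d j = 1\<close> gives \<open>e j = 0\<close>.\<close>
      define e where "e i = frob m (d i) - d i" for i
      have "(\<Sum>i\<in>A. e i * b i) = (\<Sum>i\<in>A. frob m (d i * b i)) - (\<Sum>i\<in>A. d i * b i)"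
        unfolding sum_subtractf[symmetric]
        by (rule sum.cong) (use b in \<open>auto simp: e_def frob_mult Fix_def algebra_simps\<close>)
      also have "\<dots> = 0" using d_sum by (simp flip: frob_sum)
      finally have e_sum: "(\<Sum>i\<in>A. e i * b i) = 0" .
      have "{i \<in> A. e i \<noteq> 0} \<subset> {i \<in> A. c i \<noteq> 0}"
      proof (rule psubsetI)
        show "{i \<in> A. e i \<noteq> 0} \<subseteq> {i \<in> A. c i \<noteq> 0}" by (auto simp: e_def d_def)
        have "e j = 0" using j by (simp add: e_def d_def)
        then show "{i \<in> A. e i \<noteq> 0} \<noteq> {i \<in> A. c i \<noteq> 0}" using j by blast
      qed
      then have "card {i \<in> A. e i \<noteq> 0} < card {i \<in> A. c i \<noteq> 0}"
        using \<open>finite A\<close> by (intro psubset_card_mono) auto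
      moreover have "\<forall>i\<in>A. e i \<in> Fix n" using d by (simp add: e_def Fix_simps)
      ultimately have "\<forall>i\<in>A. e i = 0" using less.hyps e_sum by blast
      then have "d i \<in> Fix 1" if "i \<in> A" for i
        using that d Fix_coprime[of "d i" n m] assms(4,5) by (simp add: e_def Fix_def)
      then have "d j = 0" using indepD[OF indep _ d_sum] j(1) by blast
      then show False using j(2) by (simp add: d_def)
    qed
  qed
qed

lemma normal_elt_indep:
  assumes "normal_elt m a" "coprime n m" "n > 0"
  shows "indep n {..<m} (\<lambda>i. frob i a)"
  by (rule indep_coprime[where m = m]) (use assms in \<open>auto simp: normal_elt_def Fix_simps\<close>)

text \<open>Sorting the conjugates of \<open>a * b\<close> by residues modulo \<open>m\<close> and
  \<open>l\<close> turns a relation into one among the conjugates of \<open>b\<close> with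
  coefficients \<open>d j\<close> in \<open>Fix m\<close>. These vanish because \<open>b\<close>
  stays normal over \<open>Fix m\<close>, and each \<open>d j = 0\<close> is a relation among the
  conjugates of \<open>a\<close>.\<close>

lemma normal_elt_mult:
  assumes a: "normal_elt m a" and b: "normal_elt l b" and "coprime m l" "m > 0" "l > 0"
  shows "normal_elt (m * l) (a * b)"
proof -
  have aF: "a \<in> Fix m" and bF: "b \<in> Fix l" using a b by (auto simp: normal_elt_def)
  have "a * b \<in> Fix (m * l)" using Fix_dvd[OF aF, of "m * l"] Fix_dvd[OF bF, of "m * l"]
    by (simp add: Fix_simps)
  moreover have "indep 1 {..<m * l} (\<lambda>k. frob k (a * b))"
    unfolding indep_def
  proof (intro allI impI, elim conjE)
    fix c assume c: "\<forall>k\<in>{..<m * l}. c k \<in> Fix 1" and zero: "(\<Sum>k<m * l. c k * frob k (a * b)) = 0"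
    let ?crt = "\<lambda>k. (k mod m, k mod l)"
    note bij = bij_betw_mod_coprime[OF assms(3-5)]
    define \<psi> where "\<psi> = the_inv_into {..<m * l} ?crt"
    have \<psi>: "\<psi> (k mod m, k mod l) = k" if "k < m * l" for k
      unfolding \<psi>_def using the_inv_into_f_f[of ?crt _ k] bij that by (simp add: bij_betw_def)
    have \<psi>_less: "\<psi> (i, j) < m * l" if "i < m" "j < l" for i j
      using bij_betw_apply[OF bij_betw_the_inv_into[OF bij], of "(i, j)"] that
      by (simp add: \<psi>_def)
    define d where "d j = (\<Sum>i<m. c (\<psi> (i, j)) * frob i a)" for j
    have "0 = (\<Sum>k<m * l. c (\<psi> (?crt k)) * (frob (k mod m) a * frob (k mod l) b))"
      unfolding zero[symmetric]
      by (rule sum.cong) (simp_all only: lessThan_iff \<psi> frob_mod[OF aF] frob_mod[OF bF] frob_mult)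
    also have "\<dots> = (\<Sum>(i, j)\<in>{..<m} \<times> {..<l}. c (\<psi> (i, j)) * (frob i a * frob j b))"
      by (subst sum.reindex_bij_betw[OF bij, symmetric]) simp
    also have "\<dots> = (\<Sum>j<l. \<Sum>i<m. c (\<psi> (i, j)) * (frob i a * frob j b))"
      by (subst sum.swap) (simp add: sum.cartesian_product)
    also have "\<dots> = (\<Sum>j<l. d j * frob j b)"
      by (simp add: d_def sum_distrib_right mult.assoc)
    finally have sum_d: "(\<Sum>j<l. d j * frob j b) = 0" by simp
    have c\<psi>: "c (\<psi> (i, j)) \<in> Fix 1" if "i < m" "j < l" for i j
      using c \<psi>_less[OF that] by blast
    have "d j \<in> Fix m" if "j < l" for j
      unfolding d_def using Fix_dvd[OF c\<psi>] that aF by (intro Fix_sum Fix_simps) auto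
    then have "d j = 0" if "j < l" for j
      using indepD[OF normal_elt_indep[OF b assms(3,4)] _ sum_d] that by simp
    then have c0: "c (\<psi> (i, j)) = 0" if "i < m" "j < l" for i j
      using indepD[of 1 "{..<m}" "\<lambda>i. frob i a" "\<lambda>i. c (\<psi> (i, j))" i] a c\<psi> that
      by (auto simp: d_def normal_elt_def)
    have "c k = 0" if "k < m * l" for k
      using c0[of "k mod m" "k mod l"] \<psi>[OF that] assms(4,5) by simp
    then show "\<forall>k\<in>{..<m * l}. c k = 0" by simp
  qed
  ultimately show ?thesis by (simp add: normal_elt_def)
qed

section \<open>Normal elements chosen multiplicatively on coprime degrees\<close>

definition prime_power_normal_elt :: "nat \<Rightarrow> 'a" where
  "prime_power_normal_elt m = (SOME a. normal_elt m a)"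

text \<open>Arbitrary choices for every degree need not multiply correctly. Choosing only at prime
  powers leaves no condition between the choices, since coprime degrees share no prime.\<close>

definition theta :: "nat \<Rightarrow> 'a" where
  "theta m = (\<Prod>r\<in>prime_factors m. prime_power_normal_elt (r ^ multiplicity r m))"

lemma normal_elt_theta:
  assumes "m > 0"
  shows "normal_elt m (theta m)"
proof -
  have "normal_elt (\<Prod>r\<in>A. r ^ multiplicity r m)
          (\<Prod>r\<in>A. prime_power_normal_elt (r ^ multiplicity r m))"
    if "finite A" "A \<subseteq> prime_factors m" for A
    using that
  proof (induction A rule: finite_induct)
    case empty
    \<comment> \<open>The empty product: \<open>1\<close> is normal in degree
      \<open>1\<close>.\<close>
    show ?case by (auto simp: normal_elt_def Fix_simps indep_def lessThan_Suc)
  next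
    case (insert r A)
    let ?e = "\<lambda>r. r ^ multiplicity r m"
    have pos: "s > 0" if "s \<in> insert r A" for s
      using that insert.prems by (auto intro: prime_gt_0_nat)
    have "coprime r s" if "s \<in> A" for s
      using that insert by (intro primes_coprime) auto
    then have "coprime (?e r) (\<Prod>s\<in>A. ?e s)"
      by (intro prod_coprime_right) auto
    moreover have "normal_elt (?e r) (prime_power_normal_elt (?e r))"
      unfolding prime_power_normal_elt_def by (rule someI_ex[OF normal_elt_exists]) (use pos in simp)
    ultimately show ?case
      using insert pos by (simp add: normal_elt_mult prod_pos)
  qed
  from this[of "prime_factors m"] show ?thesis
    using prime_factorization_nat[OF assms] by (simp add: theta_def)
qed

text \<open>The primes of \<open>m\<close> and \<open>l\<close> are disjoint, and each has in
  \<open>m * l\<close> the multiplicity it has in its own factor.\<close>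

lemma theta_mult:
  assumes "coprime m l" "m > 0" "l > 0"
  shows "theta (m * l) = theta m * theta l"
proof -
  have disj: "prime_factors m \<inter> prime_factors l = {}"
    using assms(1) by (auto simp: in_prime_factors_iff dest: coprime_common_divisor)
  have "prime_factors (m * l) = prime_factors m \<union> prime_factors l"
    using assms by (simp add: prime_factors_product)
  then have "theta (m * l) =
      (\<Prod>r\<in>prime_factors m. prime_power_normal_elt (r ^ multiplicity r (m * l))) *
      (\<Prod>r\<in>prime_factors l. prime_power_normal_elt (r ^ multiplicity r (m * l)))"
    unfolding theta_def using disj by (simp add: prod.union_disjoint)
  also have "(\<Prod>r\<in>prime_factors m. prime_power_normal_elt (r ^ multiplicity r (m * l))) = theta m"
    unfolding theta_def
  proof (rule prod.cong)
    fix r assume r: "r \<in> prime_factors m"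
    then have "r \<notin> prime_factors l" using disj by blast
    then have "multiplicity r l = 0"
      using r assms(3) by (auto simp: in_prime_factors_iff not_dvd_imp_multiplicity_0)
    then show "prime_power_normal_elt (r ^ multiplicity r (m * l)) =
        prime_power_normal_elt (r ^ multiplicity r m)"
      using r assms by (auto simp: prime_elem_multiplicity_mult_distrib in_prime_factors_iff)
  qed simp
  also have "(\<Prod>r\<in>prime_factors l. prime_power_normal_elt (r ^ multiplicity r (m * l))) = theta l"
    unfolding theta_def
  proof (rule prod.cong)
    fix r assume r: "r \<in> prime_factors l"
    then have "r \<notin> prime_factors m" using disj by blast
    then have "multiplicity r m = 0"
      using r assms(2) by (auto simp: in_prime_factors_iff not_dvd_imp_multiplicity_0)
    then show "prime_power_normal_elt (r ^ multiplicity r (m * l)) =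
        prime_power_normal_elt (r ^ multiplicity r l)"
      using r assms by (auto simp: prime_elem_multiplicity_mult_distrib in_prime_factors_iff)
  qed simp
  finally show ?thesis .
qed

text \<open>There are \<open>q ^ (n * m)\<close> coefficient vectors; independence makes their
  combinations distinct, so they fill \<open>Fix (n * m)\<close>.\<close>

lemma indep_spanning:
  assumes indep: "indep n {..<m} b" and "n > 0" "m > 0"
    and b: "\<And>i. i < m \<Longrightarrow> b i \<in> Fix (n * m)" and x: "x \<in> Fix (n * m)"
  shows "\<exists>c. (\<forall>i<m. c i \<in> Fix n) \<and> x = (\<Sum>i<m. c i * b i)"
proof -
  \<comment> \<open>Extensional functions, so that \<open>C\<close> has exactly one element per
    coefficient vector and can be counted.\<close>
  define C where "C = ({..<m} \<rightarrow>\<^sub>E Fix n)"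
  define comb where "comb c = (\<Sum>i<m. c i * b i)" for c
  have "inj_on comb C"
  proof (rule inj_onI)
    fix c d assume cd: "c \<in> C" "d \<in> C" "comb c = comb d"
    have "c i - d i = 0" if "i < m" for i
      by (rule indepD[OF indep, of "\<lambda>i. c i - d i"])
         (use cd that in \<open>auto simp: C_def comb_def algebra_simps sum_subtractf intro!: Fix_simps\<close>)
    then show "c = d" using cd(1,2) unfolding C_def by (intro PiE_ext) auto
  qed
  moreover have "comb ` C \<subseteq> Fix (n * m)"
    using b Fix_dvd[of _ n "n * m"]
    by (auto simp: C_def comb_def intro!: Fix_sum Fix_simps)
  moreover have "card C = card (Fix (n * m))"
    using assms(2,3) by (simp add: C_def card_funcsetE card_Fix power_mult)
  ultimately have "comb ` C = Fix (n * m)"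
    using assms(2,3) finite_Fix by (intro card_subset_eq) (auto simp: card_image)
  then obtain c where "c \<in> C" "x = comb c" using x by blast
  then show ?thesis by (auto simp: C_def comb_def)
qed

end

section \<open>Regular representations\<close>

text \<open>Column \<open>j\<close> of \<open>perm_mat m \<pi>\<close> is the unit vector at
  \<open>\<pi> j\<close>, so conjugation moves entry \<open>(i, j)\<close> to
  \<open>(\<pi> i, \<pi> j)\<close>. This form avoids inverse permutations.\<close>

lemma perm_conj_index:
  fixes A :: "'a::field mat"
  assumes \<pi>: "\<pi> permutes {0..<m}" and A: "A \<in> carrier_mat m m" and ij: "i < m" "j < m"
  shows "(perm_mat m \<pi> * A * transpose_mat (perm_mat m \<pi>)) $$ (\<pi> i, \<pi> j) = A $$ (i, j)"
proof -
  let ?P = "perm_mat m \<pi> :: 'a mat"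
  have P: "?P \<in> carrier_mat m m" by (simp add: perm_mat_def)
  have less: "\<pi> k < m" if "k < m" for k using permutes_in_image[OF \<pi>, of k] that by simp
  have P_index: "?P $$ (\<pi> i, k) = (if k = i then 1 else 0)" if "i < m" "k < m" for i k
    using that less permutes_inj[OF \<pi>] by (auto simp: perm_mat_def dest: injD)
  have PA: "(?P * A) $$ (\<pi> i, k) = A $$ (i, k)" if "k < m" for k
  proof -
    have "(?P * A) $$ (\<pi> i, k) = (\<Sum>t\<in>{0..<m}. ?P $$ (\<pi> i, t) * A $$ (t, k))"
      using A P ij less that by (simp add: scalar_prod_def)
    also have "\<dots> = (\<Sum>t\<in>{0..<m}. if t = i then A $$ (t, k) else 0)"
      by (rule sum.cong) (use ij in \<open>auto simp: P_index\<close>)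
    finally show ?thesis using ij by simp
  qed
  define M where "M = ?P * A"
  have M: "M \<in> carrier_mat m m" using P A by (simp add: M_def)
  have "(M * transpose_mat ?P) $$ (\<pi> i, \<pi> j) = (\<Sum>k\<in>{0..<m}. M $$ (\<pi> i, k) * ?P $$ (\<pi> j, k))"
    using M P ij less by (simp add: scalar_prod_def)
  also have "\<dots> = (\<Sum>k\<in>{0..<m}. if k = j then A $$ (i, k) else 0)"
    by (rule sum.cong) (use ij in \<open>auto simp: P_index PA M_def\<close>)
  finally show ?thesis using ij by (simp add: M_def)
qed

lemma eq_perm_conjI:
  fixes A B :: "'a::field mat"
  assumes \<pi>: "\<pi> permutes {0..<m}" and A: "A \<in> carrier_mat m m" and B: "B \<in> carrier_mat m m"
    and index: "\<And>i j. i < m \<Longrightarrow> j < m \<Longrightarrow> B $$ (\<pi> i, \<pi> j) = A $$ (i, j)"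
  shows "B = perm_mat m \<pi> * A * transpose_mat (perm_mat m \<pi>)"
proof (rule eq_matI)
  let ?C = "perm_mat m \<pi> * A * transpose_mat (perm_mat m \<pi>)"
  show "dim_row B = dim_row ?C" "dim_col B = dim_col ?C"
    using B by (simp_all add: perm_mat_def)
  fix r c assume "r < dim_row ?C" "c < dim_col ?C"
  then have "r \<in> \<pi> ` {0..<m}" "c \<in> \<pi> ` {0..<m}"
    using permutes_image[OF \<pi>] by (simp_all add: perm_mat_def)
  then show "B $$ (r, c) = ?C $$ (r, c)"
    using index perm_conj_index[OF \<pi> A] by auto
qed

section \<open>Index permutations for Frobenius and for the Chinese remainder theorem\<close>

definition shift_perm :: "nat \<Rightarrow> nat \<Rightarrow> nat \<Rightarrow> nat" where
  "shift_perm n m j = (if j < m then (j + n) mod m else j)"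

lemma shift_perm_permutes: "shift_perm n m permutes {0..<m}"
proof (rule bij_imp_permutes)
  have inj: "inj_on (shift_perm n m) {0..<m}"
  proof (rule inj_onI)
    fix i j assume *: "i \<in> {0..<m}" "j \<in> {0..<m}" "shift_perm n m i = shift_perm n m j"
    then have "[i + n = j + n] (mod m)" by (simp add: shift_perm_def cong_def)
    then have "[i = j] (mod m)" by (simp only: cong_add_rcancel_nat)
    with * show "i = j" by (simp add: cong_less_modulus_unique_nat)
  qed
  moreover have "shift_perm n m ` {0..<m} \<subseteq> {0..<m}" by (auto simp: shift_perm_def)
  ultimately show "bij_betw (shift_perm n m) {0..<m} {0..<m}"
    by (simp add: bij_betw_def endo_inj_surj)
qed (simp add: shift_perm_def)

text \<open>Iterating from \<open>0\<close> gives the multiples of \<open>n\<close>, which run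
  through all residues because \<open>n\<close> is invertible modulo \<open>m\<close>.\<close>

lemma shift_perm_cyclic:
  assumes "coprime n m" "m > 0"
  shows "cyclic_on (shift_perm n m) {0..<m}"
proof -
  have pow: "(shift_perm n m ^^ k) 0 = (k * n) mod m" for k
    by (induction k) (use \<open>m > 0\<close> in \<open>simp_all add: shift_perm_def mod_simps algebra_simps\<close>)
  obtain x where x: "[n * x = 1] (mod m)" using cong_solve_coprime_nat[OF assms(1)] by auto
  have "i \<in> orbit (shift_perm n m) 0" if "i < m" for i
  proof -
    \<comment> \<open>The extra \<open>m\<close> steps change nothing modulo \<open>m\<close> and
      keep the number of iterations positive, as \<open>orbit\<close> demands.\<close>
    have "[(x * i + m) * n = n * x * i + m * n] (mod m)" by (simp add: algebra_simps)
    also have "[n * x * i + m * n = 1 * i + 0] (mod m)"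
      by (intro cong_add cong_mult x) (simp_all add: cong_def)
    finally have "(shift_perm n m ^^ (x * i + m)) 0 = i"
      using that by (simp add: pow cong_def)
    then show ?thesis using \<open>m > 0\<close> by (auto simp: orbit_altdef intro!: exI[of _ "x * i + m"])
  qed
  then have "{0..<m} = orbit (shift_perm n m) 0"
    using \<open>m > 0\<close> by (auto simp: orbit_altdef pow)
  then show ?thesis using \<open>m > 0\<close> by (auto simp: cyclic_on_def)
qed

text \<open>Conjugate number \<open>k\<close> of \<open>theta (m * l)\<close> is the product of
  conjugate \<open>k mod m\<close> of \<open>theta m\<close> and conjugate \<open>k mod l\<close> of
  \<open>theta l\<close>. Its place in the block matrix is therefore inner index
  \<open>k mod m\<close> in block \<open>k mod l\<close>.\<close>

definition crt_perm :: "nat \<Rightarrow> nat \<Rightarrow> nat \<Rightarrow> nat" where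
  "crt_perm m l k = (if k < m * l then (k mod l) * m + k mod m else k)"

lemma crt_perm_permutes:
  assumes "coprime m l" "m > 0" "l > 0"
  shows "crt_perm m l permutes {0..<m * l}"
proof (rule bij_imp_permutes)
  have "inj_on (crt_perm m l) {0..<m * l}"
  proof (rule inj_onI)
    fix x y assume *: "x \<in> {0..<m * l}" "y \<in> {0..<m * l}" "crt_perm m l x = crt_perm m l y"
    have dm: "crt_perm m l k mod m = k mod m" "crt_perm m l k div m = k mod l" if "k < m * l" for k
      using that assms by (simp_all add: crt_perm_def)
    have "(x mod m, x mod l) = (y mod m, y mod l)"
      using dm[of x] dm[of y] * by auto
    with bij_betw_mod_coprime[OF assms] * show "x = y"
      by (auto simp: bij_betw_def dest!: inj_onD[of _ _ x y])
  qed
  moreover have "crt_perm m l ` {0..<m * l} \<subseteq> {0..<m * l}"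
  proof (rule image_subsetI)
    fix k assume k: "k \<in> {0..<m * l}"
    have "(k mod l) * m + k mod m < (k mod l) * m + m" using assms by simp
    also have "\<dots> = Suc (k mod l) * m" by simp
    also have "\<dots> \<le> l * m" using assms by (intro mult_le_mono1) (simp add: Suc_leI)
    finally show "crt_perm m l k \<in> {0..<m * l}" using k by (simp add: crt_perm_def mult.commute)
  qed
  ultimately show "bij_betw (crt_perm m l) {0..<m * l} {0..<m * l}"
    by (simp add: bij_betw_def endo_inj_surj)
qed (simp add: crt_perm_def)

section \<open>Multiplication matrices in the basis of conjugates\<close>

context frobenius_field
begin

definition basis :: "nat \<Rightarrow> nat \<Rightarrow> 'a" where
  "basis m i = frob i (theta m)"

text \<open>Columns hold the coordinates, so that composing multiplications becomes the matrix
  product in the same order.\<close>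

definition represents :: "nat \<Rightarrow> nat \<Rightarrow> 'a \<Rightarrow> 'a mat \<Rightarrow> bool" where
  "represents n m x A \<longleftrightarrow> A \<in> carrier_mat m m \<and> (\<forall>i<m. \<forall>j<m. A $$ (i, j) \<in> Fix n) \<and>
     (\<forall>j<m. x * basis m j = (\<Sum>i<m. A $$ (i, j) * basis m i))"

text \<open>The matrix exists and is unique for coprime positive \<open>n\<close>, \<open>m\<close>
  and \<open>x\<close> in \<open>Fix (n * m)\<close>. Identities are shown for
  \<open>represents\<close> and carried over by \<open>regular_rep_eqI\<close>.\<close>

definition regular_rep :: "nat \<Rightarrow> nat \<Rightarrow> 'a \<Rightarrow> 'a mat" where
  "regular_rep n m x = (THE A. represents n m x A)"

lemma theta_Fix: "m > 0 \<Longrightarrow> theta m \<in> Fix m"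
  using normal_elt_theta by (simp add: normal_elt_def)

lemma basis_Fix: "m > 0 \<Longrightarrow> basis m i \<in> Fix m"
  by (simp add: basis_def Fix_simps theta_Fix)

lemma frob_basis: "m > 0 \<Longrightarrow> frob n (basis m j) = basis m ((j + n) mod m)"
  by (simp add: basis_def frob_mod[OF theta_Fix] add.commute)

lemma basis_mult:
  assumes "coprime m l" "m > 0" "l > 0"
  shows "basis (m * l) k = basis m (k mod m) * basis l (k mod l)"
  using assms by (simp add: basis_def theta_mult frob_mult frob_mod[OF theta_Fix])

lemma indep_basis:
  assumes "coprime n m" "n > 0" "m > 0"
  shows "indep n {..<m} (basis m)"
  using normal_elt_indep[OF normal_elt_theta, of m n] assms by (simp add: basis_def[abs_def])

lemma basis_nonzero:
  assumes "m > 0"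
  shows "basis m 0 \<noteq> 0"
proof
  assume zero: "basis m 0 = 0"
  have "indep 1 {..<m} (basis m)" using indep_basis[of 1 m] assms by simp
  then have "(if (0::nat) = 0 then 1 else 0) = (0 :: 'a)"
    by (rule indepD[of _ _ _ "\<lambda>i. if i = 0 then 1 else 0"])
       (use zero assms in \<open>auto simp: Fix_simps if_distrib if_distribR cong: if_cong\<close>)
  then show False by simp
qed

lemma represents_unique:
  assumes "coprime n m" "n > 0" "m > 0" and A: "represents n m x A" and B: "represents n m x B"
  shows "A = B"
proof (rule eq_matI)
  show "dim_row A = dim_row B" "dim_col A = dim_col B"
    using A B by (auto simp: represents_def)
  fix i j assume "i < dim_row B" "j < dim_col B"
  then have ij: "i < m" "j < m" using B by (auto simp: represents_def)
  have "A $$ (i, j) - B $$ (i, j) = 0"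
    by (rule indepD[OF indep_basis[OF assms(1-3)], of "\<lambda>i. A $$ (i, j) - B $$ (i, j)"])
       (use A B ij in \<open>auto simp: represents_def Fix_simps algebra_simps sum_subtractf\<close>)
  then show "A $$ (i, j) = B $$ (i, j)" by simp
qed

lemma represents_exists:
  assumes "coprime n m" "n > 0" "m > 0" "x \<in> Fix (n * m)"
  shows "\<exists>A. represents n m x A"
proof -
  have basis: "basis m i \<in> Fix (n * m)" for i
    by (rule Fix_dvd[OF basis_Fix]) (use assms in auto)
  have "\<exists>c. (\<forall>i<m. c i \<in> Fix n) \<and> x * basis m j = (\<Sum>i<m. c i * basis m i)" for j
    by (rule indep_spanning[OF indep_basis]) (use assms basis in \<open>auto simp: Fix_simps\<close>)
  then obtain c where "\<And>j. (\<forall>i<m. c j i \<in> Fix n) \<and> x * basis m j = (\<Sum>i<m. c j i * basis m i)"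
    by metis
  then have "represents n m x (mat m m (\<lambda>(i, j). c j i))"
    by (simp add: represents_def)
  then show ?thesis by blast
qed

lemma regular_rep_eqI:
  assumes "coprime n m" "n > 0" "m > 0" "represents n m x A"
  shows "regular_rep n m x = A"
  unfolding regular_rep_def using assms represents_unique by blast

lemma represents_regular_rep:
  assumes "coprime n m" "n > 0" "m > 0" "x \<in> Fix (n * m)"
  shows "represents n m x (regular_rep n m x)"
  using represents_exists[OF assms] regular_rep_eqI[OF assms(1-3)] by metis

lemma represents_mult:
  assumes A: "represents n m x A" and B: "represents n m y B"
  shows "represents n m (x * y) (A * B)"
proof -
  have AB: "A \<in> carrier_mat m m" "B \<in> carrier_mat m m" using A B by (auto simp: represents_def)
  have index: "(A * B) $$ (i, j) = (\<Sum>k<m. A $$ (i, k) * B $$ (k, j))" if "i < m" "j < m" for i j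
    using AB that by (simp add: scalar_prod_def atLeast0LessThan)
  have "x * y * basis m j = (\<Sum>i<m. (A * B) $$ (i, j) * basis m i)" if j: "j < m" for j
  proof -
    have "x * y * basis m j = x * (\<Sum>k<m. B $$ (k, j) * basis m k)"
      using B j by (simp add: represents_def mult.assoc)
    also have "\<dots> = (\<Sum>k<m. B $$ (k, j) * (x * basis m k))"
      by (simp add: sum_distrib_left mult.left_commute)
    also have "\<dots> = (\<Sum>k<m. B $$ (k, j) * (\<Sum>i<m. A $$ (i, k) * basis m i))"
      using A by (intro sum.cong) (auto simp: represents_def)
    also have "\<dots> = (\<Sum>k<m. \<Sum>i<m. A $$ (i, k) * B $$ (k, j) * basis m i)"
      by (simp add: sum_distrib_left mult.assoc mult.left_commute)
    also have "\<dots> = (\<Sum>i<m. \<Sum>k<m. A $$ (i, k) * B $$ (k, j) * basis m i)"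
      by (rule sum.swap)
    also have "\<dots> = (\<Sum>i<m. (A * B) $$ (i, j) * basis m i)"
      using index j by (simp add: sum_distrib_right)
    finally show ?thesis .
  qed
  moreover have "(A * B) $$ (i, j) \<in> Fix n" if "i < m" "j < m" for i j
    using A B that unfolding index[OF that] by (auto simp: represents_def intro!: Fix_sum Fix_simps)
  ultimately show ?thesis using AB by (simp add: represents_def)
qed

lemma represents_add:
  assumes "represents n m x A" "represents n m y B"
  shows "represents n m (x + y) (A + B)"
  using assms by (auto simp: represents_def Fix_simps distrib_right sum.distrib)

lemma represents_one: "represents n m 1 (1\<^sub>m m)"
  by (auto simp: represents_def Fix_simps if_distrib if_distribR cong: if_cong)

lemma represents_smult:
  assumes "represents n m x A" "c \<in> Fix n"
  shows "represents n m (c * x) (c \<cdot>\<^sub>m A)"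
  using assms by (auto simp: represents_def Fix_simps sum_distrib_left mult.assoc)

text \<open>Apply \<open>frob n\<close> to the equation for column \<open>j\<close> of
  \<open>A\<close>: the entries lie in \<open>Fix n\<close> and stay, the basis elements move by
  \<open>shift_perm n m\<close>, and the result is the equation for column
  \<open>shift_perm n m j\<close> of \<open>B\<close>.\<close>

lemma represents_frob:
  assumes "m > 0" and A: "represents n m x A" and B: "B \<in> carrier_mat m m"
    and index: "\<And>i j. i < m \<Longrightarrow> j < m \<Longrightarrow> B $$ (shift_perm n m i, shift_perm n m j) = A $$ (i, j)"
  shows "represents n m (frob n x) B"
proof -
  let ?\<sigma> = "shift_perm n m"
  have bij: "bij_betw ?\<sigma> {..<m} {..<m}"
    using permutes_imp_bij[OF shift_perm_permutes] by (simp add: lessThan_atLeast0)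
  have \<sigma>: "\<exists>i<m. r = ?\<sigma> i" if "r < m" for r
    using bij that by (auto simp: bij_betw_def)
  have frob_basis': "frob n (basis m i) = basis m (?\<sigma> i)" if "i < m" for i
    using that frob_basis by (simp add: shift_perm_def)
  have col: "frob n x * basis m (?\<sigma> j) = (\<Sum>i<m. B $$ (i, ?\<sigma> j) * basis m i)" if j: "j < m" for j
  proof -
    have "frob n x * basis m (?\<sigma> j) = frob n (x * basis m j)"
      by (simp only: frob_basis'[OF j] frob_mult)
    also have "\<dots> = frob n (\<Sum>i<m. A $$ (i, j) * basis m i)"
      using A j by (simp add: represents_def)
    also have "\<dots> = (\<Sum>i<m. B $$ (?\<sigma> i, ?\<sigma> j) * basis m (?\<sigma> i))"
      unfolding frob_sum
      by (rule sum.cong) (use A j index frob_basis' in \<open>auto simp: represents_def frob_mult Fix_def\<close>)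
    also have "\<dots> = (\<Sum>i<m. B $$ (i, ?\<sigma> j) * basis m i)"
      by (rule sum.reindex_bij_betw[OF bij])
    finally show ?thesis .
  qed
  have "frob n x * basis m c = (\<Sum>i<m. B $$ (i, c) * basis m i)" if "c < m" for c
  proof -
    obtain j where "j < m" "c = ?\<sigma> j" using \<sigma> \<open>c < m\<close> by blast
    then show ?thesis using col by blast
  qed
  moreover have "B $$ (r, c) \<in> Fix n" if rc: "r < m" "c < m" for r c
  proof -
    obtain i where i: "i < m" "r = ?\<sigma> i" using \<sigma>[OF rc(1)] by blast
    obtain j where j: "j < m" "c = ?\<sigma> j" using \<sigma>[OF rc(2)] by blast
    have "A $$ (i, j) \<in> Fix n" using A i j unfolding represents_def by blast
    then show ?thesis unfolding i(2) j(2) by (simp only: index[OF i(1) j(1)])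
  qed
  ultimately show ?thesis using B by (simp add: represents_def)
qed

lemma regular_rep_frob:
  assumes "coprime n m" "n > 0" "m > 0" "x \<in> Fix (n * m)"
  shows "regular_rep n m (frob n x) =
    perm_mat m (shift_perm n m) * regular_rep n m x * transpose_mat (perm_mat m (shift_perm n m))"
proof (rule regular_rep_eqI[OF assms(1-3)], rule represents_frob)
  let ?A = "regular_rep n m x"
  show A: "represents n m x ?A" by (rule represents_regular_rep[OF assms])
  then have "?A \<in> carrier_mat m m" by (simp add: represents_def)
  then show "(perm_mat m (shift_perm n m) * ?A * transpose_mat (perm_mat m (shift_perm n m)))
      $$ (shift_perm n m i, shift_perm n m j) = ?A $$ (i, j)" if "i < m" "j < m" for i j
    using that by (rule perm_conj_index[OF shift_perm_permutes])
  show "perm_mat m (shift_perm n m) * ?A * transpose_mat (perm_mat m (shift_perm n m))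
      \<in> carrier_mat m m"
    by (rule carrier_matI) (simp_all add: perm_mat_def)
qed fact

lemma inj_on_regular_rep:
  assumes "coprime n m" "n > 0" "m > 0"
  shows "inj_on (regular_rep n m) (Fix (n * m))"
proof (rule inj_onI)
  fix x y assume xy: "x \<in> Fix (n * m)" "y \<in> Fix (n * m)" "regular_rep n m x = regular_rep n m y"
  \<comment> \<open>Column \<open>0\<close> alone determines the product with
    \<open>basis m 0\<close>.\<close>
  have "x * basis m 0 = y * basis m 0"
    using represents_regular_rep[OF assms xy(1)] represents_regular_rep[OF assms xy(2)] xy(3) assms(3)
    by (simp add: represents_def)
  then show "x = y" using basis_nonzero[OF assms(3)] by simp
qed

text \<open>Expand \<open>x\<close> times a product of conjugates of \<open>theta m\<close> and
  \<open>theta l\<close> in two stages: first in the conjugates of \<open>theta l\<close> over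
  \<open>Fix (n * m)\<close>, then each coefficient times the conjugate of \<open>theta m\<close>
  over \<open>Fix n\<close>. The coordinates are the entries of the blocks, taken with respect to
  the conjugates of \<open>theta (m * l)\<close>.\<close>

lemma regular_rep_compose:
  assumes coprime: "coprime n m" "coprime n l" "coprime m l" and pos: "n > 0" "m > 0" "l > 0"
    and x: "x \<in> Fix (n * m * l)"
  shows "flatten_blocks m l (map_mat (regular_rep n m) (regular_rep (n * m) l x)) =
    perm_mat (m * l) (crt_perm m l) * regular_rep n (m * l) x *
      transpose_mat (perm_mat (m * l) (crt_perm m l))"
    (is "?F = ?Q * _ * _")
proof -
  let ?\<pi> = "crt_perm m l"
  define A where "A = regular_rep (n * m) l x"
  define B where "B I J = regular_rep n m (A $$ (I, J))" for I J
  \<comment> \<open>The flattened matrix reindexed to the order of the conjugates of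
    \<open>theta (m * l)\<close>; uniqueness of the representing matrix will identify it with
    \<open>regular_rep n (m * l) x\<close>.\<close>
  define R where "R = mat (m * l) (m * l) (\<lambda>(k, k'). ?F $$ (?\<pi> k, ?\<pi> k'))"
  have cop: "coprime (n * m) l" "coprime n (m * l)" using coprime by simp_all
  have A: "represents (n * m) l x A"
    unfolding A_def using cop pos x by (intro represents_regular_rep) auto
  have B: "represents n m (A $$ (I, J)) (B I J)" if "I < l" "J < l" for I J
    unfolding B_def using A coprime pos that by (intro represents_regular_rep) (auto simp: represents_def)
  have R_index: "R $$ (k, k') = B (k mod l) (k' mod l) $$ (k mod m, k' mod m)"
    if "k < m * l" "k' < m * l" for k k'
    using that pos A unfolding R_def B_def
    by (auto simp: crt_perm_def index_flatten_blocks represents_def simp flip: A_def)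
  have "x * basis (m * l) k' = (\<Sum>k<m * l. R $$ (k, k') * basis (m * l) k)" if k': "k' < m * l" for k'
  proof -
    let ?j = "k' mod m" and ?J = "k' mod l"
    have j: "?j < m" "?J < l" using pos by simp_all
    have "x * basis (m * l) k' = (\<Sum>I<l. A $$ (I, ?J) * basis l I) * basis m ?j"
      using A j unfolding basis_mult[OF coprime(3) pos(2,3)] by (simp add: represents_def)
    also have "\<dots> = (\<Sum>I<l. (A $$ (I, ?J) * basis m ?j) * basis l I)"
      unfolding sum_distrib_right by (rule sum.cong) (simp_all only: mult_ac)
    also have "\<dots> = (\<Sum>I<l. (\<Sum>i<m. B I ?J $$ (i, ?j) * basis m i) * basis l I)"
      using B j by (intro sum.cong) (auto simp: represents_def)
    also have "\<dots> = (\<Sum>I<l. \<Sum>i<m. B I ?J $$ (i, ?j) * (basis m i * basis l I))"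
      by (simp add: sum_distrib_right mult.assoc)
    also have "\<dots> = (\<Sum>(i, I)\<in>{..<m} \<times> {..<l}. B I ?J $$ (i, ?j) * (basis m i * basis l I))"
      by (subst sum.swap) (simp add: sum.cartesian_product)
    also have "\<dots> = (\<Sum>k<m * l. B (k mod l) ?J $$ (k mod m, ?j) * (basis m (k mod m) * basis l (k mod l)))"
      by (subst sum.reindex_bij_betw[OF bij_betw_mod_coprime[OF coprime(3) pos(2,3)], symmetric]) simp
    also have "\<dots> = (\<Sum>k<m * l. R $$ (k, k') * basis (m * l) k)"
      using k' by (intro sum.cong) (simp_all add: R_index basis_mult[OF coprime(3) pos(2,3)])
    finally show ?thesis .
  qed
  moreover have "R $$ (k, k') \<in> Fix n" if "k < m * l" "k' < m * l" for k k'
    using B[of "k mod l" "k' mod l"] pos unfolding R_index[OF that] by (simp add: represents_def)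
  ultimately have "represents n (m * l) x R" by (simp add: represents_def R_def)
  then have "regular_rep n (m * l) x = R" using cop pos by (intro regular_rep_eqI) auto
  moreover have "?F = ?Q * R * transpose_mat ?Q"
    by (rule eq_perm_conjI[OF crt_perm_permutes]) (use coprime pos in \<open>auto simp: R_def flatten_blocks_def\<close>)
  ultimately show ?thesis by simp
qed

end

section \<open>Assembling the compatible family\<close>

theorem theorem14:
  fixes p e q :: nat and K :: "'a::field set"
  assumes "Factorial_Ring.prime p" and "e \<ge> 1" and "q = p ^ e"
    and "algebraic_closure (type_ring :: 'a ring) K" and "card K = p"
  shows "\<exists>(\<rho> :: nat \<Rightarrow> nat \<Rightarrow> 'a \<Rightarrow> 'a mat) (P :: nat \<Rightarrow> nat \<Rightarrow> 'a mat).
    (\<forall>n m. n \<ge> 1 \<and> m \<ge> 1 \<and> coprime n m \<longrightarrow>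
       cyclic_permutation_matrix m (P n m) \<and>
       GF_algebra_hom (q ^ n) (q ^ (n * m)) m (\<rho> n m) \<and>
       inj_on (\<rho> n m) (GF (q ^ (n * m))) \<and>
       (\<forall>\<xi> \<in> GF (q ^ (n * m)).
          \<rho> n m (\<xi> ^ (q ^ n)) = P n m * \<rho> n m \<xi> * transpose_mat (P n m))) \<and>
    (\<forall>n m l. n \<ge> 1 \<and> m \<ge> 1 \<and> l \<ge> 1 \<and> coprime n m \<and> coprime n l \<and> coprime m l \<longrightarrow>
       (\<exists>Q :: 'a mat. permutation_matrix (m * l) Q \<and>
          (\<forall>\<xi> \<in> GF (q ^ (n * m * l)).
             flatten_blocks m l (map_mat (\<rho> n m) (\<rho> (n * m) l \<xi>)) =
               Q * \<rho> n (m * l) \<xi> * transpose_mat Q)))"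
proof -
  note p = assms(1) and e = assms(2) and q = assms(3) and closure = assms(4,5)
  \<comment> \<open>The exponent \<open>e * n\<close> is positive for \<open>n > 0\<close>, so the
    facts on subfields of order \<open>p ^ k\<close> apply to \<open>q ^ n\<close>.\<close>
  have qn: "q ^ n = p ^ (e * n)" for n by (simp add: q power_mult)
  interpret frobenius_field q "TYPE('a)"
  proof
    show "1 < q" using one_less_power[OF prime_gt_1_nat[OF p], of e] e by (simp add: q)
    show "(x + y :: 'a) ^ q = x ^ q + y ^ q" for x y
      unfolding q by (rule prime_power_add[OF p closure])
    show "card {x :: 'a. x ^ (q ^ n) = x} = q ^ n" if "n > 0" for n
      unfolding qn using e that by (intro card_fixed_points[OF p closure]) simp
  qed
  have GF: "GF (q ^ n) = Fix n" if "n > 0" for n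
    using GF_eq[OF p closure, of "e * n"] e that by (simp add: qn Fix_def frob_def)
  show ?thesis
  proof (intro exI[of _ regular_rep] exI[of _ "\<lambda>n m. perm_mat m (shift_perm n m)"] conjI allI impI)
    fix n m :: nat
    assume nm: "n \<ge> 1 \<and> m \<ge> 1 \<and> coprime n m"
    then have pos: "coprime n m" "n > 0" "m > 0" by auto
    then have GF_nm: "GF (q ^ n) = Fix n" "GF (q ^ (n * m)) = Fix (n * m)" by (simp_all add: GF)
    note rep = represents_regular_rep[OF pos]
    show "cyclic_permutation_matrix m (perm_mat m (shift_perm n m) :: 'a mat)"
      unfolding cyclic_permutation_matrix_def
      using shift_perm_permutes shift_perm_cyclic[OF pos(1,3)] by blast
    show "inj_on (regular_rep n m) (GF (q ^ (n * m)))"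
      unfolding GF_nm by (rule inj_on_regular_rep[OF pos])
    show "\<forall>\<xi>\<in>GF (q ^ (n * m)). regular_rep n m (\<xi> ^ (q ^ n)) =
        perm_mat m (shift_perm n m) * regular_rep n m \<xi> * transpose_mat (perm_mat m (shift_perm n m))"
      unfolding GF_nm using regular_rep_frob[OF pos] by (simp add: frob_def)
    show "GF_algebra_hom (q ^ n) (q ^ (n * m)) m (regular_rep n m)"
      unfolding GF_algebra_hom_def GF_nm
    proof (intro conjI ballI)
      show "regular_rep n m \<in> Ring.ring_hom (GF_ring (q ^ (n * m))) (GF_mat_ring (q ^ n) m)"
      proof (rule Ring.ring_hom_memI)
        fix x :: 'a assume "x \<in> carrier (GF_ring (q ^ (n * m)))"
        then have x: "x \<in> Fix (n * m)" by (simp add: GF_ring_def GF_nm)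
        show "regular_rep n m x \<in> carrier (GF_mat_ring (q ^ n) m)"
          using rep[OF x] by (auto simp: GF_mat_ring_def GF_nm represents_def elements_mat_def)
        fix y :: 'a assume "y \<in> carrier (GF_ring (q ^ (n * m)))"
        then have y: "y \<in> Fix (n * m)" by (simp add: GF_ring_def GF_nm)
        show "regular_rep n m (x \<otimes>\<^bsub>GF_ring (q ^ (n * m))\<^esub> y) =
            regular_rep n m x \<otimes>\<^bsub>GF_mat_ring (q ^ n) m\<^esub> regular_rep n m y"
          using regular_rep_eqI[OF pos represents_mult[OF rep[OF x] rep[OF y]]]
          by (simp add: GF_ring_def GF_mat_ring_def ring_mat_def ring_of_type_algebra_def)
        show "regular_rep n m (x \<oplus>\<^bsub>GF_ring (q ^ (n * m))\<^esub> y) =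
            regular_rep n m x \<oplus>\<^bsub>GF_mat_ring (q ^ n) m\<^esub> regular_rep n m y"
          using regular_rep_eqI[OF pos represents_add[OF rep[OF x] rep[OF y]]]
          by (simp add: GF_ring_def GF_mat_ring_def ring_mat_def ring_of_type_algebra_def)
      next
        show "regular_rep n m \<one>\<^bsub>GF_ring (q ^ (n * m))\<^esub> = \<one>\<^bsub>GF_mat_ring (q ^ n) m\<^esub>"
          using regular_rep_eqI[OF pos represents_one]
          by (simp add: GF_ring_def GF_mat_ring_def ring_mat_def ring_of_type_algebra_def)
      qed
      show "regular_rep n m (c * x) = c \<cdot>\<^sub>m regular_rep n m x" if "c \<in> Fix n" "x \<in> Fix (n * m)" for c x
        using regular_rep_eqI[OF pos represents_smult[OF rep]] that by blast
    qed
  next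
    fix n m l :: nat
    assume "n \<ge> 1 \<and> m \<ge> 1 \<and> l \<ge> 1 \<and> coprime n m \<and> coprime n l \<and> coprime m l"
    then have pos: "coprime n m" "coprime n l" "coprime m l" "n > 0" "m > 0" "l > 0" by auto
    have "permutation_matrix (m * l) (perm_mat (m * l) (crt_perm m l) :: 'a mat)"
      unfolding permutation_matrix_def using crt_perm_permutes pos by blast
    moreover have "GF (q ^ (n * m * l)) = Fix (n * m * l)" using pos by (simp add: GF)
    ultimately show "\<exists>Q :: 'a mat. permutation_matrix (m * l) Q \<and>
          (\<forall>\<xi> \<in> GF (q ^ (n * m * l)).
             flatten_blocks m l (map_mat (regular_rep n m) (regular_rep (n * m) l \<xi>)) =
               Q * regular_rep n (m * l) \<xi> * transpose_mat Q)"
      using regular_rep_compose[OF pos] by blast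
  qed
qed

end
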